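(* Let $\mathcal{A}$ be a unital complex algebra, $\varphi:\mathcal{A}\to\mathbb{C}$ a unital linear functional, and $\mathcal{A}_1,\ldots,\mathcal{A}_n$ (not necessarily unital) subalgebras of $\mathcal{A}$ that are monotone independent (in this order) with respect to $\varphi$. Then the subalgebras $\bar T(\mathcal{A}_1),\ldots,\bar T(\mathcal{A}_n)$ of $T(\mathcal{A})$ are cyclically monotone independent with respect to $(\varphi,[\varphi])$.
   Context: Tensor algebra: $T(\mathcal{A})=\mathbb{C}1\oplus\bigoplus_{m\ge1}\mathcal{A}^{\otimes m}$ with product $\otimes$; $\bar T(\mathcal{A}_i)=\bigoplus_{m\ge1}\mathcal{A}_i^{\otimes m}$. The functional $\varphi$ is extended to $T(\mathcal{A})$ by $\varphi(a_1\otimes\cdots\otimes a_m)=\varphi(a_1\cdots a_m)$, $\varphi(1)=1$. Monotone independence of $(\mathcal{B}_1,\ldots,\mathcal{B}_n)$ with respect to $\varphi$: $\varphi(a_1\cdots a_m)=\varphi(a_k)\,\varphi(a_1\cdots a_{k-1}a_{k+1}\cdots a_m)$ whenever $a_i\in\mathcal{B}_{j_i}$, and $j_{k-1}<j_k>j_{k+1}$ (the inequality being dropped on the side where the neighbour does not exist, when $k=1$ or $k=m$). Cyclic monotone independence of a pair $(\mathcal{B}_1,\mathcal{B}_2)$ with respect to $(\varphi,\omega)$, $\omega$ a tracial linear functional: $(\mathcal{B}_1,\mathcal{B}_2)$ is monotone independent with respect to $\varphi$, and for all $m\ge1$, $a_1,\ldots,a_m\in\mathcal{B}_1$, $b_0,\ldots,b_m\in\mathcal{B}_2$,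 $$\omega(b_0a_1b_1a_2\cdots a_mb_m)=\omega(a_1\cdots a_m)\,\varphi(b_1)\cdots\varphi(b_{m-1})\,\varphi(b_mb_0).$$ A family $(\mathcal{B}_1,\ldots,\mathcal{B}_n)$ is cyclically monotone independent if, for each $2\le k\le n$, the pair formed by the (non-unital) algebra generated by $\mathcal{B}_1,\ldots,\mathcal{B}_{k-1}$ and the algebra $\mathcal{B}_k$ is cyclically monotone independent. Boolean cumulants $\beta^\varphi$ are defined recursively by $\varphi(a_1\cdots a_m)=\sum_{I}\prod_{\{i,\ldots,j\}\in I}\beta^\varphi(a_i,\ldots,a_j)$, the sum over interval partitions $I$ of $\{1,\ldots,m\}$. The functional $[\varphi]$ on $T(\mathcal{A})$ is defined by $[\varphi](1)=1$ and $$[\varphi](a_1\otimes\cdots\otimes a_m)=\sum_{\ell=1}^m\ \sum_{1\le i_1<\cdots<i_\ell\le m}\ \prod_{k=1}^{\ell}\beta^\varphi(a_{i_k},a_{i_k+1},\ldots,a_{i_{k+1}-1}),$$ with $i_{\ell+1}=i_1$ and indices read cyclically modulo $m$ (the last factor is $\beta^\varphi(a_{i_\ell},\ldots,a_m,a_1,\ldots,a_{i_1-1})$). *)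

theory Defs
  imports Complex_Main "HOL.Hull" "HOL-Library.Poly_Mapping"
begin

section \<open>Complex algebras\<close>

class complex_vector = ab_group_add +
  fixes scaleC :: "complex \<Rightarrow> 'a \<Rightarrow> 'a"  (infixr \<open>*\<^sub>C\<close> 75)
  assumes scaleC_add_right: "c *\<^sub>C (x + y) = c *\<^sub>C x + c *\<^sub>C y"
    and scaleC_add_left: "(c + d) *\<^sub>C x = c *\<^sub>C x + d *\<^sub>C x"
    and scaleC_scaleC: "c *\<^sub>C (d *\<^sub>C x) = (c * d) *\<^sub>C x"
    and scaleC_one: "1 *\<^sub>C x = x"

class complex_algebra_1 = complex_vector + ring_1 +
  assumes mult_scaleC_left: "(c *\<^sub>C x) * y = c *\<^sub>C (x * y)"
    and mult_scaleC_right: "x * (c *\<^sub>C y) = c *\<^sub>C (x * y)"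

interpretation complex_vector: vector_space "scaleC :: complex \<Rightarrow> 'a \<Rightarrow> 'a::complex_vector"
  by unfold_locales (rule scaleC_add_right scaleC_add_left scaleC_scaleC scaleC_one)+

abbreviation linear_functional :: "('a::complex_vector \<Rightarrow> complex) \<Rightarrow> bool"
  where "linear_functional \<equiv> Vector_Spaces.linear scaleC (*)"

definition nonunital_subalgebra :: "'a::complex_algebra_1 set \<Rightarrow> bool"
  where "nonunital_subalgebra B \<longleftrightarrow>
    complex_vector.subspace B \<and> (\<forall>x\<in>B. \<forall>y\<in>B. x * y \<in> B)"

definition generated_algebra :: "'a::complex_algebra_1 set \<Rightarrow> 'a set"
  where "generated_algebra X = nonunital_subalgebra hull X"

section \<open>Monotone and cyclic monotone independence\<close>

definition monotone_independent ::
    "('a::complex_algebra_1 \<Rightarrow> complex) \<Rightarrow> nat \<Rightarrow> (nat \<Rightarrow> 'a set) \<Rightarrow> bool"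
  where "monotone_independent \<phi> n B \<longleftrightarrow>
    (\<forall>m a j k. 1 \<le> k \<and> k \<le> m \<and>
        (\<forall>i\<in>{1..m}. j i \<in> {1..n} \<and> a i \<in> B (j i)) \<and>
        (1 < k \<longrightarrow> j (k - 1) < j k) \<and> (k < m \<longrightarrow> j k > j (k + 1)) \<longrightarrow>
      \<phi> (prod_list (map a [1..<m + 1])) =
        \<phi> (a k) * \<phi> (prod_list (map a ([1..<k] @ [k + 1..<m + 1]))))"

definition tracial :: "('a::complex_algebra_1 \<Rightarrow> complex) \<Rightarrow> bool"
  where "tracial \<omega> \<longleftrightarrow> (\<forall>x y. \<omega> (x * y) = \<omega> (y * x))"

definition cyclically_monotone_pair ::
    "('a::complex_algebra_1 \<Rightarrow> complex) \<Rightarrow> ('a \<Rightarrow> complex) \<Rightarrow> 'a set \<Rightarrow> 'a set \<Rightarrow> bool"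
  where "cyclically_monotone_pair \<phi> \<omega> B\<^sub>1 B\<^sub>2 \<longleftrightarrow>
    monotone_independent \<phi> 2 (\<lambda>i. if i = 1 then B\<^sub>1 else B\<^sub>2) \<and>
    (\<forall>m a b. 1 \<le> m \<and> (\<forall>i\<in>{1..m}. a i \<in> B\<^sub>1) \<and> (\<forall>i\<in>{0..m}. b i \<in> B\<^sub>2) \<longrightarrow>
      \<omega> (b 0 * prod_list (map (\<lambda>i. a i * b i) [1..<m + 1])) =
        \<omega> (prod_list (map a [1..<m + 1])) * (\<Prod>i\<in>{1..<m}. \<phi> (b i)) * \<phi> (b m * b 0))"

text \<open>The standing requirement that \<open>\<omega>\<close> is a tracial linear functional is part of the
  definition, so that it has to be verified wherever this independence is asserted.\<close>

definition cyclically_monotone_independent ::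
    "('a::complex_algebra_1 \<Rightarrow> complex) \<Rightarrow> ('a \<Rightarrow> complex) \<Rightarrow> nat \<Rightarrow> (nat \<Rightarrow> 'a set) \<Rightarrow> bool"
  where "cyclically_monotone_independent \<phi> \<omega> n B \<longleftrightarrow>
    linear_functional \<omega> \<and> tracial \<omega> \<and>
    (\<forall>k\<in>{2..n}. cyclically_monotone_pair \<phi> \<omega>
       (generated_algebra (\<Union>i\<in>{1..<k}. B i)) (B k))"

section \<open>The tensor algebra\<close>

text \<open>With concatenation as addition on lists, \<^typ>\<open>'a list \<Rightarrow>\<^sub>0 complex\<close> is the free unital complex
  algebra on the set underlying \<^typ>\<open>'a\<close>. The tensor algebra is its quotient by the smallest
  congruence (equivalently, by the two-sided ideal) making \<open>a \<mapsto> [a]\<close> linear.\<close>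

instantiation list :: (type) monoid_add
begin
definition zero_list :: "'a list" where "zero_list = []"
definition plus_list :: "'a list \<Rightarrow> 'a list \<Rightarrow> 'a list" where "plus_list = (@)"
instance by standard (simp_all add: zero_list_def plus_list_def)
end

inductive tensor_cong ::
    "('a::complex_vector list \<Rightarrow>\<^sub>0 complex) \<Rightarrow> ('a list \<Rightarrow>\<^sub>0 complex) \<Rightarrow> bool"
  where
    add_letter: "tensor_cong (Poly_Mapping.single [a + b] 1)
                  (Poly_Mapping.single [a] 1 + Poly_Mapping.single [b] 1)"
  | scale_letter: "tensor_cong (Poly_Mapping.single [c *\<^sub>C a] 1) (Poly_Mapping.single [a] c)"
  | refl: "tensor_cong p p"
  | sym: "tensor_cong p q \<Longrightarrow> tensor_cong q p"
  | trans: "tensor_cong p q \<Longrightarrow> tensor_cong q r \<Longrightarrow> tensor_cong p r"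
  | add: "tensor_cong p q \<Longrightarrow> tensor_cong p' q' \<Longrightarrow> tensor_cong (p + p') (q + q')"
  | mult: "tensor_cong p q \<Longrightarrow> tensor_cong p' q' \<Longrightarrow> tensor_cong (p * p') (q * q')"

quotient_type (overloaded) 'a tensor_algebra = "'a::complex_vector list \<Rightarrow>\<^sub>0 complex" / tensor_cong
  by (rule equivpI)
    (auto intro!: reflpI sympI transpI intro: tensor_cong.refl tensor_cong.sym tensor_cong.trans)

text \<open>Evaluation of a formal linear combination of words under a function on words.\<close>

definition formal_eval :: "('a list \<Rightarrow> complex) \<Rightarrow> ('a list \<Rightarrow>\<^sub>0 complex) \<Rightarrow> complex"
  where "formal_eval f p = (\<Sum>w\<in>Poly_Mapping.keys p. Poly_Mapping.lookup p w * f w)"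

definition multilinear :: "('a::complex_vector list \<Rightarrow> complex) \<Rightarrow> bool"
  where "multilinear f \<longleftrightarrow>
    (\<forall>u a b v. f (u @ (a + b) # v) = f (u @ a # v) + f (u @ b # v)) \<and>
    (\<forall>u c a v. f (u @ (c *\<^sub>C a) # v) = c * f (u @ a # v))"

lemma formal_eval_superset:
  assumes "finite S" "Poly_Mapping.keys p \<subseteq> S"
  shows "formal_eval f p = (\<Sum>w\<in>S. Poly_Mapping.lookup p w * f w)"
  unfolding formal_eval_def
  by (rule sum.mono_neutral_left) (use assms in \<open>auto simp: in_keys_iff\<close>)

lemma formal_eval_zero [simp]: "formal_eval f 0 = 0"
  by (simp add: formal_eval_def)

lemma formal_eval_single [simp]: "formal_eval f (Poly_Mapping.single w c) = c * f w"
  by (simp add: formal_eval_def)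

lemma formal_eval_add: "formal_eval f (p + q) = formal_eval f p + formal_eval f q"
proof -
  let ?S = "Poly_Mapping.keys p \<union> Poly_Mapping.keys q"
  have "Poly_Mapping.keys (p + q) \<subseteq> ?S"
    by (rule Poly_Mapping.keys_add)
  then show ?thesis
    by (simp add: formal_eval_superset[of ?S] lookup_add distrib_right sum.distrib)
qed

lemma free_algebra_induct [case_names zero add]:
  fixes p :: "'a list \<Rightarrow>\<^sub>0 complex"
  assumes "P 0" and "\<And>w c p. P p \<Longrightarrow> P (Poly_Mapping.single w c + p)"
  shows "P p"
proof (induction p rule: Poly_Mapping.update_induct)
  case const
  show ?case by (rule assms(1))
next
  case (update p w c)
  have "Poly_Mapping.update w c p = Poly_Mapping.single w c + p"
    using update(1)
    by (auto intro!: poly_mapping_eqI simp: lookup_add lookup_update lookup_single in_keys_iff when_def)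
  then show ?case using assms(2)[OF update(3)] by simp
qed

lemma formal_eval_sandwich:
  assumes "\<And>u c v d. formal_eval f (Poly_Mapping.single u c * p * Poly_Mapping.single v d) =
                   formal_eval f (Poly_Mapping.single u c * q * Poly_Mapping.single v d)"
  shows "formal_eval f (x * p * y) = formal_eval f (x * q * y)"
proof -
  have *: "formal_eval f (Poly_Mapping.single u c * p * y) =
           formal_eval f (Poly_Mapping.single u c * q * y)" for u c
    by (induction y rule: free_algebra_induct) (simp_all add: distrib_left formal_eval_add assms)
  show ?thesis
    by (induction x rule: free_algebra_induct) (simp_all add: distrib_right formal_eval_add *)
qed

lemma formal_eval_tensor_cong:
  assumes "multilinear f" "tensor_cong p q"
  shows "formal_eval f p = formal_eval f q"
proof -
  have "formal_eval f (x * p * y) = formal_eval f (x * q * y)" for x y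
    using assms(2)
  proof (induction arbitrary: x y rule: tensor_cong.induct)
    case (add_letter a b)
    show ?case
      by (rule formal_eval_sandwich)
        (use assms(1) in \<open>simp add: mult_single distrib_left distrib_right formal_eval_add
          plus_list_def multilinear_def\<close>)
  next
    case (scale_letter c a)
    show ?case
      by (rule formal_eval_sandwich)
        (use assms(1) in \<open>simp add: mult_single plus_list_def multilinear_def\<close>)
  next
    case (add p q p' q')
    then show ?case by (simp add: distrib_left distrib_right formal_eval_add)
  next
    case (mult p q p' q')
    have "formal_eval f (x * (p * p') * y) = formal_eval f (x * p * (p' * y))"
      by (simp add: mult.assoc)
    also have "\<dots> = formal_eval f ((x * q) * p' * y)"
      using mult.IH(1)[of x "p' * y"] by (simp add: mult.assoc)
    also have "\<dots> = formal_eval f (x * (q * q') * y)"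
      using mult.IH(2)[of "x * q" y] by (simp add: mult.assoc)
    finally show ?case .
  qed simp_all
  from this[of 1 1] show ?thesis by simp
qed

lemma formal_eval_scale:
  "formal_eval f (Poly_Mapping.single 0 c * p) = c * formal_eval f p"
  by (induction p rule: free_algebra_induct)
    (simp_all add: distrib_left formal_eval_add mult_single)

lemma single_zero_central:
  "p * Poly_Mapping.single (0 :: 'a list) (c::complex) = Poly_Mapping.single 0 c * p"
  by (induction p rule: free_algebra_induct)
    (simp_all add: distrib_left distrib_right mult_single mult.commute)

lemma single_zero_uminus: "Poly_Mapping.single (0 :: 'a list) (- 1 :: complex) * p = - p"
proof -
  have "Poly_Mapping.single (0 :: 'a list) (- 1 :: complex) = - 1"
    by (metis single_one single_uminus)
  then show ?thesis by simp
qed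

lemma tensor_cong_uminus:
  assumes "tensor_cong p q"
  shows "tensor_cong (- p) (- q)"
  using tensor_cong.mult[OF tensor_cong.refl[of "Poly_Mapping.single 0 (- 1)"] assms]
  by (simp add: single_zero_uminus)

instantiation tensor_algebra :: (complex_vector) complex_algebra_1
begin

lift_definition zero_tensor_algebra :: "'a tensor_algebra" is 0 .

lift_definition one_tensor_algebra :: "'a tensor_algebra" is 1 .

lift_definition plus_tensor_algebra :: "'a tensor_algebra \<Rightarrow> 'a tensor_algebra \<Rightarrow> 'a tensor_algebra"
  is "(+)" by (rule tensor_cong.add)

lift_definition uminus_tensor_algebra :: "'a tensor_algebra \<Rightarrow> 'a tensor_algebra"
  is uminus by (rule tensor_cong_uminus)

lift_definition minus_tensor_algebra :: "'a tensor_algebra \<Rightarrow> 'a tensor_algebra \<Rightarrow> 'a tensor_algebra"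
  is "(-)"
  unfolding diff_conv_add_uminus by (intro tensor_cong.add tensor_cong_uminus)

lift_definition times_tensor_algebra :: "'a tensor_algebra \<Rightarrow> 'a tensor_algebra \<Rightarrow> 'a tensor_algebra"
  is "(*)" by (rule tensor_cong.mult)

lift_definition scaleC_tensor_algebra :: "complex \<Rightarrow> 'a tensor_algebra \<Rightarrow> 'a tensor_algebra"
  is "\<lambda>c p. Poly_Mapping.single 0 c * p"
  by (intro tensor_cong.mult tensor_cong.refl)

instance
proof
  show "(0 :: 'a tensor_algebra) \<noteq> 1"
  proof (transfer, rule notI)
    assume "tensor_cong (0 :: 'a list \<Rightarrow>\<^sub>0 complex) 1"
    moreover have "multilinear (\<lambda>w :: 'a list. if w = [] then 1 else 0)"
      by (simp add: multilinear_def)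
    ultimately have "formal_eval (\<lambda>w :: 'a list. if w = [] then 1 else 0) 0 =
        formal_eval (\<lambda>w :: 'a list. if w = [] then 1 else 0) 1"
      using formal_eval_tensor_cong by blast
    then show False
      by (simp add: zero_list_def flip: single_one)
  qed
next
  fix c d :: complex and x y :: "'a tensor_algebra"
  show "c *\<^sub>C (x + y) = c *\<^sub>C x + c *\<^sub>C y"
    by transfer (simp add: distrib_left tensor_cong.refl)
  show "(c + d) *\<^sub>C x = c *\<^sub>C x + d *\<^sub>C x"
    by transfer (simp add: distrib_right single_add tensor_cong.refl)
  show "c *\<^sub>C (d *\<^sub>C x) = (c * d) *\<^sub>C x"
    by transfer (simp add: mult_single tensor_cong.refl flip: mult.assoc)
  show "1 *\<^sub>C x = x"
    by transfer (simp add: tensor_cong.refl)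
  show "(c *\<^sub>C x) * y = c *\<^sub>C (x * y)"
    by transfer (simp add: mult.assoc tensor_cong.refl)
  show "x * (c *\<^sub>C y) = c *\<^sub>C (x * y)"
    by transfer (simp add: single_zero_central tensor_cong.refl flip: mult.assoc)
qed (transfer; simp add: algebra_simps tensor_cong.refl)+

end

lift_definition pure_tensor :: "'a::complex_vector list \<Rightarrow> 'a tensor_algebra"
  is "\<lambda>w. Poly_Mapping.single w 1" .

lemma pure_tensor_Nil: "pure_tensor [] = 1"
  by transfer (simp add: tensor_cong.refl flip: zero_list_def)

lemma pure_tensor_append: "pure_tensor (u @ v) = pure_tensor u * pure_tensor v"
  by transfer (simp add: mult_single plus_list_def tensor_cong.refl)

text \<open>The linear functional on the tensor algebra with prescribed values on pure tensors. It does
  not depend on the choice of representatives if \<open>f\<close> is multilinear.\<close>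

definition tensor_functional :: "('a::complex_vector list \<Rightarrow> complex) \<Rightarrow> 'a tensor_algebra \<Rightarrow> complex"
  where "tensor_functional f t = formal_eval f (rep_tensor_algebra t)"

lemma tensor_functional_abs:
  assumes "multilinear f"
  shows "tensor_functional f (abs_tensor_algebra p) = formal_eval f p"
  unfolding tensor_functional_def
  by (intro formal_eval_tensor_cong assms Quotient3_rep_abs[OF Quotient3_tensor_algebra]
      tensor_cong.refl)

lemma tensor_functional_pure_tensor:
  "multilinear f \<Longrightarrow> tensor_functional f (pure_tensor w) = f w"
  by (simp add: pure_tensor.abs_eq tensor_functional_abs)

lemma tensor_functional_linear:
  assumes "multilinear f"
  shows "linear_functional (tensor_functional f)"
proof -
  have rep: "\<exists>p. x = abs_tensor_algebra p" for x :: "'a tensor_algebra"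
    using Quotient3_abs_rep[OF Quotient3_tensor_algebra] by metis
  have "tensor_functional f (x + y) = tensor_functional f x + tensor_functional f y" for x y
    using rep[of x] rep[of y]
    by (auto simp: plus_tensor_algebra.abs_eq tensor_functional_abs[OF assms] formal_eval_add)
  moreover have "tensor_functional f (c *\<^sub>C x) = c * tensor_functional f x" for c x
    using rep[of x]
    by (auto simp: scaleC_tensor_algebra.abs_eq tensor_functional_abs[OF assms] formal_eval_scale)
  ultimately show ?thesis
    by unfold_locales (simp_all add: algebra_simps)
qed

text \<open>The image of the tensor algebra of \<open>B\<close>, without its degree-zero part, in the full tensor
  algebra.\<close>

definition reduced_tensor_algebra :: "'a::complex_vector set \<Rightarrow> 'a tensor_algebra set"
  where "reduced_tensor_algebra B =
    complex_vector.span {pure_tensor w | w. w \<noteq> [] \<and> set w \<subseteq> B}"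

section \<open>Functionals on the tensor algebra\<close>

definition tensor_moment :: "('a::complex_algebra_1 \<Rightarrow> complex) \<Rightarrow> 'a tensor_algebra \<Rightarrow> complex"
  where "tensor_moment \<phi> = tensor_functional (\<lambda>as. \<phi> (prod_list as))"

lemma tensor_moment_pure_tensor:
  assumes "linear_functional \<phi>"
  shows "tensor_moment \<phi> (pure_tensor as) = \<phi> (prod_list as)"
proof -
  interpret Vector_Spaces.linear scaleC "(*)" \<phi> by (rule assms)
  show ?thesis
    unfolding tensor_moment_def
    by (rule tensor_functional_pure_tensor)
      (simp add: multilinear_def distrib_left distrib_right mult_scaleC_left mult_scaleC_right
        add scale)
qed

text \<open>An interval partition of the positions of a list is encoded as the list of its consecutive
  nonempty blocks.\<close>

definition interval_partitions :: "'a list \<Rightarrow> 'a list list set"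
  where "interval_partitions as = {bs. concat bs = as \<and> [] \<notin> set bs}"

lemma finite_interval_partitions: "finite (interval_partitions as)"
proof (rule finite_subset)
  show "interval_partitions as \<subseteq>
      {bs. set bs \<subseteq> {b. set b \<subseteq> set as \<and> length b \<le> length as} \<and> length bs \<le> length as}"
  proof
    fix bs assume "bs \<in> interval_partitions as"
    then have *: "as = concat bs" "[] \<notin> set bs"
      by (auto simp: interval_partitions_def)
    have "length b \<le> length (concat bs)" if "b \<in> set bs" for b
      using that by (simp add: length_concat member_le_sum_list)
    moreover have "length bs \<le> length (concat bs)"
      using *(2)
    proof (induction bs)
      case (Cons b bs)
      then show ?case by (cases b) auto
    qed simp
    ultimately show "bs \<in> {bs. set bs \<subseteq> {b. set b \<subseteq> set as \<and> length b \<le> length as} \<and>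
        length bs \<le> length as}"
      using *(1) by auto
  qed
qed (intro finite_lists_length_le finite_set)

lemma interval_partitions_singleton: "as \<noteq> [] \<Longrightarrow> [as] \<in> interval_partitions as"
  by (simp add: interval_partitions_def)

lemma interval_partitions_block_less:
  assumes "bs \<in> interval_partitions as" "bs \<noteq> [as]" "b \<in> set bs"
  shows "length b < length as"
proof -
  obtain us vs where bs: "bs = us @ b # vs"
    using assms(3) by (meson split_list)
  have as: "as = concat bs" and ne: "[] \<notin> set bs"
    using assms(1) by (auto simp: interval_partitions_def)
  have "bs = [as]" if "us = []" "vs = []"
    unfolding as bs that by simp
  then have "us \<noteq> [] \<or> vs \<noteq> []"
    using assms(2) by blast
  moreover have "concat us \<noteq> []" if "us \<noteq> []"
    using that ne bs by (cases us) auto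
  moreover have "concat vs \<noteq> []" if "vs \<noteq> []"
    using that ne bs by (cases vs) auto
  ultimately have "0 < length (concat us) \<or> 0 < length (concat vs)"
    by blast
  moreover have "length as = length (concat us) + length b + length (concat vs)"
    unfolding as bs by (simp only: concat_append concat.simps length_append add.assoc)
  ultimately show ?thesis
    by linarith
qed

text \<open>The one-block term of the moment-cumulant formula is isolated to obtain a recursion; the
  formula itself is the lemma after the definition.\<close>

function boolean_cumulant :: "('a::complex_algebra_1 \<Rightarrow> complex) \<Rightarrow> 'a list \<Rightarrow> complex"
  where "boolean_cumulant \<phi> as = \<phi> (prod_list as) -
    (\<Sum>bs\<in>interval_partitions as - {[as]}. prod_list (map (boolean_cumulant \<phi>) bs))"
  by pat_completeness auto
termination
  by (relation "measure (\<lambda>(\<phi>, as). length as)") (simp, fastforce intro: interval_partitions_block_less)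

declare boolean_cumulant.simps [simp del]

lemma moment_boolean_cumulant:
  assumes "as \<noteq> []"
  shows "\<phi> (prod_list as) =
    (\<Sum>bs\<in>interval_partitions as. prod_list (map (boolean_cumulant \<phi>) bs))"
proof -
  have "(\<Sum>bs\<in>interval_partitions as. prod_list (map (boolean_cumulant \<phi>) bs)) =
      boolean_cumulant \<phi> as +
      (\<Sum>bs\<in>interval_partitions as - {[as]}. prod_list (map (boolean_cumulant \<phi>) bs))"
    by (subst sum.remove[OF finite_interval_partitions interval_partitions_singleton[OF assms]]) simp
  also have "\<dots> = \<phi> (prod_list as)"
    by (subst boolean_cumulant.simps) simp
  finally show ?thesis ..
qed

text \<open>The arc of the cyclic word \<open>as\<close> from the \<open>k\<close>-th element of \<open>S\<close> up to, but excluding, the next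
  one; the last arc wraps around. Positions and \<open>k\<close> are counted from \<open>0\<close>.\<close>

definition cyclic_arc :: "'a list \<Rightarrow> nat set \<Rightarrow> nat \<Rightarrow> 'a list"
  where "cyclic_arc as S k = (let is = sorted_list_of_set S in
    if k + 1 < card S then map ((!) as) [is ! k..<is ! (k + 1)]
    else map ((!) as) ([is ! k..<length as] @ [0..<is ! 0]))"

definition cyclic_boolean_sum :: "('a::complex_algebra_1 \<Rightarrow> complex) \<Rightarrow> 'a list \<Rightarrow> complex"
  where "cyclic_boolean_sum \<phi> as = (if as = [] then 1
    else \<Sum>S | S \<noteq> {} \<and> S \<subseteq> {0..<length as}.
      \<Prod>k\<in>{0..<card S}. boolean_cumulant \<phi> (cyclic_arc as S k))"

definition cyclic_functional :: "('a::complex_algebra_1 \<Rightarrow> complex) \<Rightarrow> 'a tensor_algebra \<Rightarrow> complex"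
  where "cyclic_functional \<phi> = tensor_functional (cyclic_boolean_sum \<phi>)"

end

theory Submission
  imports Defs
begin

text \<open>
  Write \<open>M\<close>, \<open>\<beta>\<close> and \<open>\<Omega>\<close> for the moments, the Boolean cumulants and the values of the cyclic
  functional on words. Splitting off the first block of an interval partition gives the
  recursion \<open>M w = \<Sum> \<beta> u * M v\<close> over \<open>w = u @ v\<close> with \<open>u \<noteq> []\<close>. Singling out the smallest and the
  largest cutting point of a cyclic word gives \<open>\<Omega> w = \<Sum> M v * \<beta> (z @ u)\<close> over \<open>w = u @ v @ z\<close>
  with \<open>z \<noteq> []\<close>.

  Let \<open>Y\<close> be the top algebra and \<open>X\<close> the union of the lower ones. By induction on the length, monotone
  independence and the recursion give, for a nonempty word \<open>b\<close> in \<open>Y\<close> and words \<open>x\<close>, \<open>y\<close> whose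
  letters next to \<open>b\<close> are in \<open>X\<close>, that \<open>\<beta> (x @ b) = 0\<close> and \<open>\<beta> (x @ b @ y) = M b * \<beta> (x @ y)\<close>.
  Inserted into the formula for \<open>\<Omega>\<close> this yields \<open>\<Omega> (b @ y) = M b * \<Omega> y\<close> when \<open>y\<close> begins and ends
  in \<open>X\<close>, and by traciality the blocks of top letters of a cyclic word can be removed one by one.
\<close>

section \<open>Sums over the splittings of a word\<close>

text \<open>The sums run over all \<open>u\<close>, \<open>v\<close> with \<open>u @ v = w\<close> and \<open>u \<noteq> []\<close> (\<open>psum\<close>), respectively \<open>v \<noteq> []\<close>
  (\<open>ssum\<close>).\<close>

primrec psum :: "'a list \<Rightarrow> ('a list \<Rightarrow> 'a list \<Rightarrow> 'b::comm_monoid_add) \<Rightarrow> 'b" where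
  "psum [] f = 0"
| "psum (a # w) f = f [a] w + psum w (\<lambda>u. f (a # u))"

primrec ssum :: "'a list \<Rightarrow> ('a list \<Rightarrow> 'a list \<Rightarrow> 'b::comm_monoid_add) \<Rightarrow> 'b" where
  "ssum [] f = 0"
| "ssum (a # w) f = f [] (a # w) + ssum w (\<lambda>u. f (a # u))"

lemma psum_cong:
  "(\<And>u v. u @ v = w \<Longrightarrow> u \<noteq> [] \<Longrightarrow> f u v = g u v) \<Longrightarrow> psum w f = psum w g"
proof (induction w arbitrary: f g)
  case (Cons a w)
  have "psum w (\<lambda>u. f (a # u)) = psum w (\<lambda>u. g (a # u))"
    by (rule Cons.IH) (simp add: Cons.prems)
  then show ?case by (simp add: Cons.prems)
qed simp

lemma ssum_cong:
  "(\<And>u v. u @ v = w \<Longrightarrow> v \<noteq> [] \<Longrightarrow> f u v = g u v) \<Longrightarrow> ssum w f = ssum w g"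
proof (induction w arbitrary: f g)
  case (Cons a w)
  have "ssum w (\<lambda>u. f (a # u)) = ssum w (\<lambda>u. g (a # u))"
    by (rule Cons.IH) (simp add: Cons.prems)
  then show ?case by (simp add: Cons.prems)
qed simp

lemma psum_append: "psum (x @ y) f = psum x (\<lambda>u v. f u (v @ y)) + psum y (\<lambda>u. f (x @ u))"
  by (induction x arbitrary: f) (simp_all add: add.assoc)

lemma ssum_append: "ssum (x @ y) f = ssum x (\<lambda>u v. f u (v @ y)) + ssum y (\<lambda>u. f (x @ u))"
  by (induction x arbitrary: f) (simp_all add: add.assoc)

lemma psum_ssum: "f [] w + psum w f = ssum w f + f w []"
proof (induction w arbitrary: f)
  case (Cons a w)
  from Cons.IH[of "\<lambda>u. f (a # u)"] show ?case by (simp add: add.assoc)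
qed simp

lemma psum_add: "psum w (\<lambda>u v. f u v + g u v) = psum w f + psum w g"
  by (induction w arbitrary: f g) (simp_all add: ac_simps)

lemma ssum_add: "ssum w (\<lambda>u v. f u v + g u v) = ssum w f + ssum w g"
  by (induction w arbitrary: f g) (simp_all add: ac_simps)

lemma psum_mult: "psum w (\<lambda>u v. c * f u v) = c * psum w f" for c :: "'b::semiring_0"
  by (induction w arbitrary: f) (simp_all add: distrib_left)

lemma ssum_mult: "ssum w (\<lambda>u v. c * f u v) = c * ssum w f" for c :: "'b::semiring_0"
  by (induction w arbitrary: f) (simp_all add: distrib_left)

lemma psum_zero [simp]: "psum w (\<lambda>u v. 0) = 0"
  by (induction w) simp_all

lemma ssum_zero [simp]: "ssum w (\<lambda>u v. 0) = 0"
  by (induction w) simp_all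

lemma psum_whole: "w \<noteq> [] \<Longrightarrow> psum w (\<lambda>u v. if v = [] then g u else 0) = g w"
proof (induction w arbitrary: g)
  case (Cons a w)
  then show ?case by (cases "w = []") simp_all
qed simp

lemma ssum_whole: "w \<noteq> [] \<Longrightarrow> ssum w (\<lambda>u v. if u = [] then g v else 0) = g w"
  by (cases w) simp_all

lemma psum_ssum_swap:
  "psum w (\<lambda>u r. ssum r (\<lambda>v z. h u v z)) = ssum w (\<lambda>x z. psum x (\<lambda>u v. h u v z))"
  by (induction w arbitrary: h) (simp_all add: ssum_add)

lemma psum_eq_sum: "psum w f = (\<Sum>i\<in>{1..length w}. f (take i w) (drop i w))"
proof (induction w arbitrary: f)
  case (Cons a w)
  have "(\<Sum>i\<in>{1..Suc (length w)}. f (take i (a # w)) (drop i (a # w))) =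
      f [a] w + (\<Sum>i\<in>{Suc 1..Suc (length w)}. f (take i (a # w)) (drop i (a # w)))"
    by (subst sum.atLeast_Suc_atMost) simp_all
  then show ?case by (simp add: Cons.IH sum.shift_bounds_cl_Suc_ivl del: sum.cl_ivl_Suc)
qed simp

lemma ssum_eq_sum: "ssum w f = (\<Sum>i<length w. f (take i w) (drop i w))"
  by (induction w arbitrary: f) (simp_all add: sum.lessThan_Suc_shift del: sum.lessThan_Suc)

section \<open>Sums over sets of cutting points\<close>

fun chain :: "(nat \<Rightarrow> nat \<Rightarrow> 'b::comm_semiring_1) \<Rightarrow> (nat \<Rightarrow> 'b) \<Rightarrow> nat list \<Rightarrow> 'b" where
  "chain f g [] = 1"
| "chain f g [i] = g i"
| "chain f g (i # j # is) = f i j * chain f g (j # is)"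

lemma chain_eq_prod:
  "is \<noteq> [] \<Longrightarrow>
    chain f g is = (\<Prod>k<length is - 1. f (is ! k) (is ! (k + 1))) * g (last is)"
  by (induction f g "is" rule: chain.induct)
    (simp_all add: prod.lessThan_Suc_shift mult.assoc del: prod.lessThan_Suc)

lemma sum_chain_rec:
  assumes "i < n"
  shows "(\<Sum>S | S \<subseteq> {i..<n} \<and> i \<in> S. chain f g (sorted_list_of_set S)) =
    g i + (\<Sum>r\<in>{i<..<n}. f i r * (\<Sum>S | S \<subseteq> {r..<n} \<and> r \<in> S. chain f g (sorted_list_of_set S)))"
proof -
  let ?T = "\<lambda>r. {S. S \<subseteq> {r..<n} \<and> r \<in> S}"
  let ?c = "\<lambda>S. chain f g (sorted_list_of_set S)"
  have fin: "finite (?T r)" for r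
    by (rule finite_subset[of _ "Pow {r..<n}"]) auto
  have T: "?T i = insert {i} (\<Union>r\<in>{i<..<n}. insert i ` ?T r)"
  proof (intro equalityI subsetI)
    fix S assume S: "S \<in> ?T i"
    show "S \<in> insert {i} (\<Union>r\<in>{i<..<n}. insert i ` ?T r)"
    proof (cases "S = {i}")
      case False
      let ?S = "S - {i}"
      have "finite ?S" "?S \<noteq> {}"
        using S False finite_subset[of S "{i..<n}"] by auto
      then have m: "Min ?S \<in> ?S" "\<And>x. x \<in> ?S \<Longrightarrow> Min ?S \<le> x"
        using Min_in[of ?S] Min_le[of ?S] by blast+
      define r where "r = Min ?S"
      have "r \<in> S" "r \<noteq> i" using m(1) by (simp_all add: r_def)
      then have r: "r \<in> {i<..<n}" using S by fastforce
      have "?S \<subseteq> {r..<n}" using m(2) S unfolding r_def by fastforce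
      then have "?S \<in> ?T r" using \<open>r \<in> S\<close> \<open>r \<noteq> i\<close> by simp
      moreover have "S = insert i ?S" using S by auto
      ultimately have "S \<in> insert i ` ?T r" by (rule rev_image_eqI)
      then show ?thesis using r by blast
    qed simp
  next
    fix S assume "S \<in> insert {i} (\<Union>r\<in>{i<..<n}. insert i ` ?T r)"
    then consider "S = {i}" | r S' where "r \<in> {i<..<n}" "S' \<in> ?T r" "S = insert i S'" by blast
    then show "S \<in> ?T i"
    proof cases
      case 2
      have "{r..<n} \<subseteq> {i..<n}" using 2(1) by auto
      then show ?thesis using 2 assms by auto
    qed (use assms in simp)
  qed
  have inj: "inj_on (insert i) (?T r)" if "r \<in> {i<..<n}" for r
    using that by (intro inj_on_inverseI[where g = "\<lambda>S. S - {i}"]) auto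
  have c: "?c (insert i S) = f i r * ?c S" if "r \<in> {i<..<n}" "S \<in> ?T r" for r S
  proof -
    have S: "finite S" "S \<noteq> {}" "i \<notin> S" "\<forall>x\<in>S. i < x"
      using that finite_subset[of S "{r..<n}"] by auto
    have "Min S = r" using that S(1) by (intro Min_eqI) auto
    then obtain "is" where "is": "sorted_list_of_set S = r # is"
      using sorted_list_of_set_nonempty[OF S(1,2)] by simp
    have "Min (insert i S) = i" using S by (intro Min_eqI) auto
    then have "sorted_list_of_set (insert i S) = i # sorted_list_of_set S"
      using sorted_list_of_set_nonempty[of "insert i S"] S by simp
    then show ?thesis using "is" by simp
  qed
  have disj: "insert i ` ?T r \<inter> insert i ` ?T r' = {}" if "r \<in> {i<..<n}" "r' \<in> {i<..<n}" "r < r'" for r r'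
  proof -
    have "r \<in> insert i S" if "S \<in> ?T r" for S using that by simp
    moreover have "r \<notin> insert i S" if "S \<in> ?T r'" for S
      using that \<open>r < r'\<close> \<open>r \<in> {i<..<n}\<close> by auto
    ultimately show ?thesis by blast
  qed
  have "(\<Sum>S\<in>?T i. ?c S) = ?c {i} + (\<Sum>S\<in>(\<Union>r\<in>{i<..<n}. insert i ` ?T r). ?c S)"
    unfolding T
  proof (rule sum.insert)
    show "finite (\<Union>r\<in>{i<..<n}. insert i ` ?T r)" using fin by blast
    show "{i} \<notin> (\<Union>r\<in>{i<..<n}. insert i ` ?T r)" by auto
  qed
  also have "(\<Sum>S\<in>(\<Union>r\<in>{i<..<n}. insert i ` ?T r). ?c S) =
      (\<Sum>r\<in>{i<..<n}. \<Sum>S\<in>insert i ` ?T r. ?c S)"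
  proof (rule sum.UNION_disjoint)
    show "\<forall>r\<in>{i<..<n}. \<forall>r'\<in>{i<..<n}. r \<noteq> r' \<longrightarrow> insert i ` ?T r \<inter> insert i ` ?T r' = {}"
    proof (intro ballI impI)
      fix r r' assume "r \<in> {i<..<n}" "r' \<in> {i<..<n}" "r \<noteq> r'"
      then show "insert i ` ?T r \<inter> insert i ` ?T r' = {}"
      proof (cases r r' rule: linorder_cases)
        case less
        show ?thesis by (rule disj) fact+
      next
        case greater
        have "insert i ` ?T r' \<inter> insert i ` ?T r = {}" by (rule disj) fact+
        then show ?thesis by (simp only: Int_commute)
      qed blast
    qed
    show "\<forall>r\<in>{i<..<n}. finite (insert i ` ?T r)" using fin by blast
  qed simp
  also have "\<dots> = (\<Sum>r\<in>{i<..<n}. f i r * (\<Sum>S\<in>?T r. ?c S))"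
  proof (rule sum.cong)
    fix r assume r: "r \<in> {i<..<n}"
    have "(\<Sum>S\<in>insert i ` ?T r. ?c S) = (\<Sum>S\<in>?T r. ?c (insert i S))"
      by (simp add: sum.reindex[OF inj[OF r]])
    also have "\<dots> = (\<Sum>S\<in>?T r. f i r * ?c S)"
      by (rule sum.cong[OF HOL.refl c[OF r]])
    finally show "(\<Sum>S\<in>insert i ` ?T r. ?c S) = f i r * (\<Sum>S\<in>?T r. ?c S)"
      by (simp only: sum_distrib_left)
  qed simp
  finally show ?thesis by simp
qed

text \<open>A functional satisfying the first-block recursion absorbs all cutting points except the first
  and the last one.\<close>

lemma sum_chain:
  assumes one: "\<And>i. m i i = 1"
    and rec: "\<And>i q. i < q \<Longrightarrow> q < n \<Longrightarrow> m i q = (\<Sum>r\<in>{i<..q}. f i r * m r q)"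
    and "i < n"
  shows "(\<Sum>S | S \<subseteq> {i..<n} \<and> i \<in> S. chain f g (sorted_list_of_set S)) =
    (\<Sum>q\<in>{i..<n}. m i q * g q)"
  using assms(3)
proof (induction "n - i" arbitrary: i rule: less_induct)
  case less
  have "(\<Sum>S | S \<subseteq> {i..<n} \<and> i \<in> S. chain f g (sorted_list_of_set S)) =
      g i + (\<Sum>r\<in>{i<..<n}. f i r * (\<Sum>q\<in>{r..<n}. m r q * g q))"
    unfolding sum_chain_rec[OF less.prems]
    by (intro arg_cong2[where f = "(+)"] sum.cong HOL.refl arg_cong2[where f = "(*)"] less.hyps) auto
  also have "(\<Sum>r\<in>{i<..<n}. f i r * (\<Sum>q\<in>{r..<n}. m r q * g q)) =
      (\<Sum>r\<in>{i<..<n}. \<Sum>q | q \<in> {i<..<n} \<and> r \<le> q. f i r * m r q * g q)"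
    unfolding sum_distrib_left by (intro sum.cong) (auto simp: mult.assoc)
  also have "\<dots> = (\<Sum>q\<in>{i<..<n}. \<Sum>r | r \<in> {i<..<n} \<and> r \<le> q. f i r * m r q * g q)"
    by (rule sum.swap_restrict) simp_all
  also have "\<dots> = (\<Sum>q\<in>{i<..<n}. m i q * g q)"
  proof (rule sum.cong)
    fix q assume q: "q \<in> {i<..<n}"
    have "{r. r \<in> {i<..<n} \<and> r \<le> q} = {i<..q}" using q by auto
    then show "(\<Sum>r | r \<in> {i<..<n} \<and> r \<le> q. f i r * m r q * g q) = m i q * g q"
      using q by (simp add: rec sum_distrib_right)
  qed simp
  also have "g i + \<dots> = (\<Sum>q\<in>insert i {i<..<n}. m i q * g q)"
    by (simp add: one)
  also have "insert i {i<..<n} = {i..<n}" using less.prems by auto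
  finally show ?case .
qed

section \<open>Boolean cumulants and the cyclic functional on words\<close>

lemma interval_partitions_Nil: "interval_partitions [] = {[]}"
proof -
  have "bs = []" if "concat bs = []" "[] \<notin> set bs" for bs :: "'a list list"
    using that by (cases bs) auto
  then show ?thesis by (auto simp: interval_partitions_def)
qed

lemma interval_partitions_rec:
  assumes "w \<noteq> []"
  shows "interval_partitions w =
    (\<Union>i\<in>{1..length w}. (#) (take i w) ` interval_partitions (drop i w))"
proof (intro equalityI subsetI)
  fix bs assume "bs \<in> interval_partitions w"
  then have bs: "concat bs = w" "[] \<notin> set bs" by (auto simp: interval_partitions_def)
  with assms obtain b bs' where [simp]: "bs = b # bs'" by (cases bs) auto
  have "b \<noteq> []" using bs by auto
  have "length b \<in> {1..length w}" using \<open>b \<noteq> []\<close> bs(1) by (cases b) auto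
  moreover have "bs = take (length b) w # bs'" using bs(1) by auto
  moreover have "bs' \<in> interval_partitions (drop (length b) w)"
    using bs by (auto simp: interval_partitions_def)
  ultimately show "bs \<in> (\<Union>i\<in>{1..length w}. (#) (take i w) ` interval_partitions (drop i w))"
    by blast
next
  fix bs assume "bs \<in> (\<Union>i\<in>{1..length w}. (#) (take i w) ` interval_partitions (drop i w))"
  then show "bs \<in> interval_partitions w"
    by (auto simp: interval_partitions_def)
qed

lemma sum_interval_partitions:
  assumes "w \<noteq> []"
  shows "sum F (interval_partitions w) = psum w (\<lambda>u v. \<Sum>bs\<in>interval_partitions v. F (u # bs))"
proof -
  have "sum F (interval_partitions w) =
      (\<Sum>i\<in>{1..length w}. sum F ((#) (take i w) ` interval_partitions (drop i w)))"
    unfolding interval_partitions_rec[OF assms]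
  proof (rule sum.UNION_disjoint)
    show "\<forall>i\<in>{1..length w}. \<forall>j\<in>{1..length w}. i \<noteq> j \<longrightarrow>
        (#) (take i w) ` interval_partitions (drop i w) \<inter>
        (#) (take j w) ` interval_partitions (drop j w) = {}"
    proof (intro ballI impI)
      fix i j assume "i \<in> {1..length w}" "j \<in> {1..length w}" "i \<noteq> j"
      then have "length (take i w) \<noteq> length (take j w)" by simp
      then have "take i w \<noteq> take j w" by metis
      then show "(#) (take i w) ` interval_partitions (drop i w) \<inter>
        (#) (take j w) ` interval_partitions (drop j w) = {}" by blast
    qed
  qed (auto intro: finite_interval_partitions)
  then show ?thesis by (simp add: psum_eq_sum sum.reindex)
qed

locale unital_functional =
  fixes \<phi> :: "'a::complex_algebra_1 \<Rightarrow> complex"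
  assumes linear: "linear_functional \<phi>"
    and unital: "\<phi> 1 = 1"
begin

abbreviation M :: "'a list \<Rightarrow> complex" where "M w \<equiv> \<phi> (prod_list w)"
abbreviation \<beta> :: "'a list \<Rightarrow> complex" where "\<beta> \<equiv> boolean_cumulant \<phi>"
abbreviation \<Omega> :: "'a list \<Rightarrow> complex" where "\<Omega> \<equiv> cyclic_boolean_sum \<phi>"

lemma phi_add: "\<phi> (a + b) = \<phi> a + \<phi> b"
proof -
  interpret Vector_Spaces.linear scaleC "(*)" \<phi> by (rule linear)
  show ?thesis by (rule add)
qed

lemma phi_scale: "\<phi> (c *\<^sub>C a) = c * \<phi> a"
proof -
  interpret Vector_Spaces.linear scaleC "(*)" \<phi> by (rule linear)
  show ?thesis by (rule scale)
qed

lemma M_add: "M (u @ (a + b) # v) = M (u @ a # v) + M (u @ b # v)"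
  by (simp add: distrib_left distrib_right phi_add)

lemma M_scale: "M (u @ (c *\<^sub>C a) # v) = c * M (u @ a # v)"
  by (simp add: mult_scaleC_left mult_scaleC_right phi_scale)

lemma M_multilinear: "multilinear M"
  using M_add M_scale by (simp add: multilinear_def)

lemma M_psum:
  assumes "w \<noteq> []"
  shows "M w = psum w (\<lambda>u v. \<beta> u * M v)"
proof -
  have IP: "(\<Sum>bs\<in>interval_partitions v. prod_list (map \<beta> bs)) = M v" for v
  proof (cases "v = []")
    case True
    then show ?thesis by (simp add: interval_partitions_Nil unital)
  qed (rule moment_boolean_cumulant[symmetric])
  have "M w = psum w (\<lambda>u v. \<Sum>bs\<in>interval_partitions v. prod_list (map \<beta> (u # bs)))"
    by (simp only: moment_boolean_cumulant[OF assms, of \<phi>] sum_interval_partitions[OF assms])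
  then show ?thesis by (simp add: IP flip: sum_distrib_left)
qed

lemma M_ssum:
  assumes "w \<noteq> []"
  shows "M w = ssum w (\<lambda>v z. M v * \<beta> z)"
  using assms
proof (induction "length w" arbitrary: w rule: less_induct)
  case less
  have "M w = psum w (\<lambda>u v. ssum v (\<lambda>v z. \<beta> u * M v * \<beta> z) + (if v = [] then \<beta> u else 0))"
    unfolding M_psum[OF less.prems]
  proof (rule psum_cong)
    fix u v assume "u @ v = w" "u \<noteq> []"
    then have "length v < length w" by (cases u) auto
    from less.hyps[OF this]
    show "\<beta> u * M v = ssum v (\<lambda>v z. \<beta> u * M v * \<beta> z) + (if v = [] then \<beta> u else 0)"
      by (simp add: mult.assoc ssum_mult unital)
  qed
  also have "\<dots> = ssum w (\<lambda>x z. psum x (\<lambda>u v. \<beta> u * M v * \<beta> z)) + \<beta> w"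
    by (simp add: psum_add psum_whole[OF less.prems] psum_ssum_swap)
  also have "\<beta> w = ssum w (\<lambda>x z. if x = [] then \<beta> z else 0)"
    by (simp add: ssum_whole[OF less.prems])
  also have "ssum w (\<lambda>x z. psum x (\<lambda>u v. \<beta> u * M v * \<beta> z)) + \<dots> = ssum w (\<lambda>v z. M v * \<beta> z)"
    unfolding ssum_add[symmetric]
  proof (rule ssum_cong)
    fix x z
    show "psum x (\<lambda>u v. \<beta> u * M v * \<beta> z) + (if x = [] then \<beta> z else 0) = M x * \<beta> z"
      using psum_mult[of x "\<beta> z" "\<lambda>u v. \<beta> u * M v"] M_psum[of x]
      by (simp add: mult.commute unital)
  qed
  finally show ?case .
qed

text \<open>All cumulants on the right-hand side that contain \<open>a\<close> have a shorter tail behind it, which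
  permits induction on \<open>v\<close>.\<close>

lemma \<beta>_split:
  "\<beta> (u @ a # v) = M (u @ a # v) - psum u (\<lambda>s t. \<beta> s * M (t @ a # v)) -
    ssum v (\<lambda>s t. \<beta> (u @ a # s) * M t)"
proof -
  have "M (u @ a # v) = psum u (\<lambda>s t. \<beta> s * M (t @ a # v)) +
      (\<beta> (u @ [a]) * M v + psum v (\<lambda>s t. \<beta> (u @ a # s) * M t))"
    by (subst M_psum) (simp_all add: psum_append)
  also have "\<beta> (u @ [a]) * M v + psum v (\<lambda>s t. \<beta> (u @ a # s) * M t) =
      ssum v (\<lambda>s t. \<beta> (u @ a # s) * M t) + \<beta> (u @ a # v)"
    using psum_ssum[of "\<lambda>s t. \<beta> (u @ a # s) * M t" v] by (simp add: unital)
  finally show ?thesis by simp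
qed

lemma \<beta>_add: "\<beta> (u @ (a + b) # v) = \<beta> (u @ a # v) + \<beta> (u @ b # v)"
proof (induction "length v" arbitrary: v rule: less_induct)
  case less
  have "ssum v (\<lambda>s t. \<beta> (u @ (a + b) # s) * M t) =
      ssum v (\<lambda>s t. \<beta> (u @ a # s) * M t + \<beta> (u @ b # s) * M t)"
    by (rule ssum_cong) (auto simp: less.hyps distrib_right)
  moreover have "psum u (\<lambda>s t. \<beta> s * M (t @ (a + b) # v)) =
      psum u (\<lambda>s t. \<beta> s * M (t @ a # v) + \<beta> s * M (t @ b # v))"
    by (simp only: M_add distrib_left)
  ultimately show ?case
    unfolding \<beta>_split[of u _ v] M_add by (simp add: ssum_add psum_add)
qed

lemma \<beta>_scale: "\<beta> (u @ (c *\<^sub>C a) # v) = c * \<beta> (u @ a # v)"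
proof (induction "length v" arbitrary: v rule: less_induct)
  case less
  have "ssum v (\<lambda>s t. \<beta> (u @ (c *\<^sub>C a) # s) * M t) = ssum v (\<lambda>s t. c * (\<beta> (u @ a # s) * M t))"
    by (rule ssum_cong) (auto simp: less.hyps)
  moreover have "psum u (\<lambda>s t. \<beta> s * M (t @ (c *\<^sub>C a) # v)) =
      psum u (\<lambda>s t. c * (\<beta> s * M (t @ a # v)))"
    by (simp only: M_scale mult.left_commute)
  ultimately show ?case
    unfolding \<beta>_split[of u _ v] M_scale by (simp add: ssum_mult psum_mult right_diff_distrib)
qed

end

context unital_functional
begin

lemma prod_cyclic_arc:
  assumes S: "S \<subseteq> {p..<length w}" "p \<in> S"
  shows "(\<Prod>k\<in>{0..<card S}. \<beta> (cyclic_arc w S k)) =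
    chain (\<lambda>i j. \<beta> (drop i (take j w))) (\<lambda>q. \<beta> (drop q w @ take p w)) (sorted_list_of_set S)"
proof -
  define "is" where "is = sorted_list_of_set S"
  define l where "l = card S - 1"
  have fin: "finite S" using S finite_subset by blast
  have "card S > 0" using fin S(2) by (auto simp: card_gt_0_iff)
  then have set: "set is = S" and len: "length is = Suc l"
    using fin by (simp_all add: is_def l_def)
  have ne: "is \<noteq> []" using len by auto
  have "Min S = p" using S fin by (intro Min_eqI) auto
  then have hd: "is ! 0 = p"
    using sorted_list_of_set_nonempty[OF fin] \<open>card S > 0\<close> by (auto simp: is_def card_gt_0_iff)
  have slice: "map ((!) w) [i..<j] = drop i (take j w)" if "j \<le> length w" for i j
    using that by (intro nth_equalityI) auto
  have bound: "is ! k < length w" if "k \<le> l" for k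
    using nth_mem[of k "is"] that set len S(1) by auto
  have card: "card S = Suc l" using len fin by (simp add: is_def)
  have "cyclic_arc w S k = drop (is ! k) (take (is ! (k + 1)) w)" if "k < l" for k
    using that bound[of "k + 1"] slice[of "is ! (k + 1)" "is ! k"]
    by (simp add: cyclic_arc_def card is_def[symmetric] Let_def)
  moreover have "cyclic_arc w S l = drop (last is) w @ take p w"
    using bound[of 0] slice[of "length w" "is ! l"] slice[of p 0] hd last_conv_nth[OF ne] len
    by (simp add: cyclic_arc_def card is_def[symmetric] Let_def)
  ultimately show ?thesis
    using chain_eq_prod[OF ne, of "\<lambda>i j. \<beta> (drop i (take j w))" "\<lambda>q. \<beta> (drop q w @ take p w)"] len
    by (simp add: card is_def[symmetric] atLeast0LessThan)
qed

lemma M_append: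
  assumes "x \<noteq> []"
  shows "M (x @ y) = psum x (\<lambda>s t. \<beta> s * M (t @ y)) + psum y (\<lambda>s t. \<beta> (x @ s) * M t)"
  using M_psum[of "x @ y"] assms by (simp only: psum_append append_is_Nil_conv simp_thms)

lemma M_slice:
  assumes "i < q" "q < length w"
  shows "M (drop i (take q w)) = (\<Sum>r\<in>{i<..q}. \<beta> (drop i (take r w)) * M (drop r (take q w)))"
proof -
  let ?v = "drop i (take q w)"
  have "M ?v = (\<Sum>k\<in>{1..q - i}. \<beta> (take k ?v) * M (drop k ?v))"
    using assms by (subst M_psum) (simp_all add: psum_eq_sum)
  also have "\<dots> = (\<Sum>r\<in>{i<..q}. \<beta> (drop i (take r w)) * M (drop r (take q w)))"
  proof (rule sum.reindex_bij_witness[of _ "\<lambda>r. r - i" "\<lambda>k. k + i"])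
    fix k assume "k \<in> {1..q - i}"
    then have "k + i \<le> q" using assms(1) by auto
    then have "take k ?v = drop i (take (k + i) w)"
      by (simp add: take_drop min_def)
    then show "\<beta> (drop i (take (k + i) w)) * M (drop (k + i) (take q w)) = \<beta> (take k ?v) * M (drop k ?v)"
      by simp
  qed auto
  finally show ?thesis .
qed

lemma \<Omega>_ssum:
  assumes "w \<noteq> []"
  shows "\<Omega> w = ssum w (\<lambda>u r. ssum r (\<lambda>v z. M v * \<beta> (z @ u)))"
proof -
  let ?n = "length w"
  let ?F = "\<lambda>S. \<Prod>k\<in>{0..<card S}. \<beta> (cyclic_arc w S k)"
  let ?X = "{S. S \<noteq> {} \<and> S \<subseteq> {0..<?n}}"
  have "\<Omega> w = (\<Sum>S\<in>?X. ?F S)"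
    using assms by (simp add: cyclic_boolean_sum_def)
  also have "\<dots> = (\<Sum>p<?n. \<Sum>S | S \<in> ?X \<and> Min S = p. ?F S)"
  proof (rule sum.group[symmetric])
    show "finite ?X" by (rule finite_subset[of _ "Pow {0..<?n}"]) auto
    show "Min ` ?X \<subseteq> {..<?n}"
    proof (rule image_subsetI)
      fix S assume S: "S \<in> ?X"
      then have "finite S" using finite_subset by blast
      then have "Min S \<in> S" using S by simp
      then show "Min S \<in> {..<?n}" using S by auto
    qed
  qed simp
  also have "\<dots> = (\<Sum>p<?n. \<Sum>q\<in>{p..<?n}. M (drop p (take q w)) * \<beta> (drop q w @ take p w))"
  proof (rule sum.cong)
    fix p assume p: "p \<in> {..<?n}"
    have "{S. S \<in> ?X \<and> Min S = p} = {S. S \<subseteq> {p..<?n} \<and> p \<in> S}" (is "?L = ?R")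
    proof (intro equalityI subsetI)
      fix S assume S: "S \<in> ?L"
      then have "finite S" using finite_subset by blast
      then have "p \<in> S" "\<And>x. x \<in> S \<Longrightarrow> p \<le> x" using S Min_in[of S] Min_le[of S] by auto
      then show "S \<in> ?R" using S by auto
    next
      fix S assume S: "S \<in> ?R"
      then have "finite S" using finite_subset by blast
      then have "Min S = p" using S by (intro Min_eqI) auto
      moreover have "{p..<?n} \<subseteq> {0..<?n}" by auto
      ultimately show "S \<in> ?L" using S by auto
    qed
    then have "(\<Sum>S | S \<in> ?X \<and> Min S = p. ?F S) = (\<Sum>S | S \<subseteq> {p..<?n} \<and> p \<in> S.
        chain (\<lambda>i j. \<beta> (drop i (take j w))) (\<lambda>q. \<beta> (drop q w @ take p w)) (sorted_list_of_set S))"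
      by (intro sum.cong) (simp_all add: prod_cyclic_arc)
    also have "\<dots> = (\<Sum>q\<in>{p..<?n}. M (drop p (take q w)) * \<beta> (drop q w @ take p w))"
      by (rule sum_chain) (use p in \<open>simp_all add: M_slice unital\<close>)
    finally show "(\<Sum>S | S \<in> ?X \<and> Min S = p. ?F S) =
      (\<Sum>q\<in>{p..<?n}. M (drop p (take q w)) * \<beta> (drop q w @ take p w))" .
  qed simp
  also have "\<dots> = (\<Sum>p<?n. \<Sum>k<?n - p. M (take k (drop p w)) * \<beta> (drop k (drop p w) @ take p w))"
  proof (rule sum.cong)
    fix p assume "p \<in> {..<?n}"
    show "(\<Sum>q\<in>{p..<?n}. M (drop p (take q w)) * \<beta> (drop q w @ take p w)) =
        (\<Sum>k<?n - p. M (take k (drop p w)) * \<beta> (drop k (drop p w) @ take p w))"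
      by (rule sum.reindex_bij_witness[of _ "\<lambda>k. k + p" "\<lambda>q. q - p"]) (auto simp: drop_take)
  qed simp
  also have "\<dots> = ssum w (\<lambda>u r. ssum r (\<lambda>v z. M v * \<beta> (z @ u)))"
    by (simp add: ssum_eq_sum)
  finally show ?thesis .
qed

lemma \<Omega>_Cons: "\<Omega> (a # w) = M (a # w) + ssum w (\<lambda>u r. ssum r (\<lambda>v z. M v * \<beta> (z @ a # u)))"
  using M_ssum[of "a # w"] by (subst \<Omega>_ssum) simp_all

lemma \<Omega>_rotate1: "\<Omega> (w @ [a]) = \<Omega> (a # w)"
proof -
  have "M (a # w) = ssum w (\<lambda>s t. M t * \<beta> (a # s)) + \<beta> (a # w)"
    using psum_ssum[of "\<lambda>s t. M t * \<beta> (a # s)" w] by (subst M_psum) (simp_all add: unital mult.commute)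
  then show ?thesis
    by (subst \<Omega>_ssum) (simp_all add: \<Omega>_Cons ssum_append ssum_add unital)
qed

lemma \<Omega>_commute: "\<Omega> (u @ v) = \<Omega> (v @ u)"
proof (induction u arbitrary: v)
  case (Cons a u)
  have "\<Omega> ((a # u) @ v) = \<Omega> (u @ (v @ [a]))"
    using \<Omega>_rotate1[of "u @ v" a] by simp
  then show ?case by (simp add: Cons.IH)
qed simp

lemma \<Omega>_multilinear: "multilinear \<Omega>"
proof -
  have "\<Omega> (u @ (a + b) # v) = \<Omega> (u @ a # v) + \<Omega> (u @ b # v)" for u a b v
    using M_add[of "[]" a b "v @ u"]
    by (simp add: \<Omega>_commute[of u] \<Omega>_Cons \<beta>_add distrib_left ssum_add)
  moreover have "\<Omega> (u @ (c *\<^sub>C a) # v) = c * \<Omega> (u @ a # v)" for u c a v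
    using M_scale[of "[]" c a "v @ u"]
    by (simp add: \<Omega>_commute[of u] \<Omega>_Cons \<beta>_scale distrib_left ssum_mult mult.left_commute[of _ c])
  ultimately show ?thesis by (simp add: multilinear_def)
qed

end

section \<open>Removing a block of top letters\<close>

locale monotone_letters = unital_functional +
  fixes X Y :: "'a set"
  assumes M_factor: "\<lbrakk>set u \<subseteq> X \<union> Y; set v \<subseteq> X \<union> Y; b \<noteq> []; set b \<subseteq> Y;
      u \<noteq> [] \<Longrightarrow> last u \<in> X; v \<noteq> [] \<Longrightarrow> hd v \<in> X\<rbrakk> \<Longrightarrow> M (u @ b @ v) = M b * M (u @ v)"
begin

lemma \<beta>_low_top:
  assumes x: "x \<noteq> []" "set x \<subseteq> X \<union> Y" "last x \<in> X" and b: "b \<noteq> []" "set b \<subseteq> Y"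
  shows "\<beta> (x @ b) = 0"
  using b
proof (induction "length b" arbitrary: b rule: less_induct)
  case less
  have "psum x (\<lambda>s t. \<beta> s * M (t @ b)) = psum x (\<lambda>s t. M b * (\<beta> s * M t))"
  proof (rule psum_cong)
    fix s t assume "s @ t = x"
    then have "M (t @ b @ []) = M b * M (t @ [])"
      using x less.prems by (intro M_factor) auto
    then show "\<beta> s * M (t @ b) = M b * (\<beta> s * M t)" by (simp del: prod_list.append)
  qed
  also have "\<dots> = M b * M x" by (simp only: psum_mult M_psum[OF x(1)])
  finally have 1: "psum x (\<lambda>s t. \<beta> s * M (t @ b)) = M b * M x" .
  have "psum b (\<lambda>s t. \<beta> (x @ s) * M t) = psum b (\<lambda>s t. if t = [] then \<beta> (x @ s) else 0)"
  proof (rule psum_cong)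
    fix s t assume "s @ t = b" "s \<noteq> []"
    then show "\<beta> (x @ s) * M t = (if t = [] then \<beta> (x @ s) else 0)"
      using less.hyps[of s] less.prems by (auto simp: unital)
  qed
  also have "\<dots> = \<beta> (x @ b)" by (rule psum_whole) fact
  finally have "M (x @ b) = M b * M x + \<beta> (x @ b)"
    using 1 by (simp only: M_append[OF x(1)])
  moreover have "M (x @ b @ []) = M b * M (x @ [])"
    using x less.prems by (intro M_factor) auto
  ultimately show ?case by (simp del: prod_list.append)
qed

lemma \<beta>_low_top_low:
  assumes x: "x \<noteq> []" "set x \<subseteq> X \<union> Y" "last x \<in> X" and b: "b \<noteq> []" "set b \<subseteq> Y"
    and y: "y \<noteq> []" "set y \<subseteq> X \<union> Y" "hd y \<in> X"
  shows "\<beta> (x @ b @ y) = M b * \<beta> (x @ y)"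
  using y
proof (induction "length y" arbitrary: y rule: less_induct)
  case less
  have "psum x (\<lambda>s t. \<beta> s * M (t @ b @ y)) = psum x (\<lambda>s t. M b * (\<beta> s * M (t @ y)))"
  proof (rule psum_cong)
    fix s t assume "s @ t = x"
    then have "M (t @ b @ y) = M b * M (t @ y)"
      using x b less.prems by (intro M_factor) auto
    then show "\<beta> s * M (t @ b @ y) = M b * (\<beta> s * M (t @ y))" by (simp del: prod_list.append)
  qed
  then have 1: "psum x (\<lambda>s t. \<beta> s * M (t @ b @ y)) = M b * psum x (\<lambda>s t. \<beta> s * M (t @ y))"
    by (simp only: psum_mult)
  have "psum b (\<lambda>s t. \<beta> (x @ s) * M (t @ y)) = psum b (\<lambda>s t. 0)"
  proof (rule psum_cong)
    fix s t assume "s @ t = b" "s \<noteq> []"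
    then show "\<beta> (x @ s) * M (t @ y) = 0" using b(2) by (subst \<beta>_low_top[OF x]) auto
  qed
  then have 2: "psum b (\<lambda>s t. \<beta> (x @ s) * M (t @ y)) = 0" by (simp only: psum_zero)
  let ?d = "\<lambda>s. \<beta> (x @ b @ s) - M b * \<beta> (x @ s)"
  have "psum y (\<lambda>s t. \<beta> (x @ b @ s) * M t) =
      psum y (\<lambda>s t. M b * (\<beta> (x @ s) * M t) + (if t = [] then ?d s else 0))"
  proof (rule psum_cong)
    fix s t assume st: "s @ t = y" "s \<noteq> []"
    then have "hd s = hd y" "set s \<subseteq> set y" by auto
    then show "\<beta> (x @ b @ s) * M t = M b * (\<beta> (x @ s) * M t) + (if t = [] then ?d s else 0)"
      using less.hyps[of s] st less.prems by (auto simp: unital)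
  qed
  also have "\<dots> = M b * psum y (\<lambda>s t. \<beta> (x @ s) * M t) + ?d y"
    by (simp only: psum_add psum_mult psum_whole[OF less.prems(1)])
  finally have 3: "psum y (\<lambda>s t. \<beta> (x @ b @ s) * M t) =
    M b * psum y (\<lambda>s t. \<beta> (x @ s) * M t) + ?d y" .
  have "M (x @ b @ y) = M b * M (x @ y) + ?d y"
    unfolding M_append[OF x(1)] psum_append 1 2 3 by (simp add: distrib_left)
  moreover have "M (x @ b @ y) = M b * M (x @ y)"
    using x b less.prems by (intro M_factor) auto
  ultimately show ?case by simp
qed

lemma \<Omega>_top_low:
  assumes b: "b \<noteq> []" "set b \<subseteq> Y"
    and y: "y \<noteq> []" "set y \<subseteq> X \<union> Y" "hd y \<in> X" "last y \<in> X"
  shows "\<Omega> (b @ y) = M b * \<Omega> y"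
proof -
  obtain c b' where c: "b = c # b'" using b(1) by (cases b) auto
  obtain x y' where x: "y = x # y'" using y(1) by (cases y) auto
  let ?Z = "\<lambda>u r. ssum r (\<lambda>v z. M v * \<beta> (z @ u))"
  have "ssum b' (\<lambda>u r. ?Z (c # u) (r @ y)) = ssum b' (\<lambda>u r. 0)"
  proof (rule ssum_cong)
    fix u r assume ur: "u @ r = b'"
    have "?Z (c # u) (r @ y) = ssum (r @ y) (\<lambda>v z. 0)"
    proof (rule ssum_cong)
      fix v z assume "v @ z = r @ y" "z \<noteq> []"
      then have "last z = last y" "set z \<subseteq> set r \<union> set y"
        using y(1) by (metis last_appendR, metis Un_upper2 set_append)
      moreover have "set r \<subseteq> Y" using ur b(2) c by auto
      ultimately have "last z = last y" "set z \<subseteq> X \<union> Y" using y(2) by blast+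
      then show "M v * \<beta> (z @ c # u) = 0"
        using \<open>z \<noteq> []\<close> b(2) y ur c by (subst \<beta>_low_top) auto
    qed
    then show "?Z (c # u) (r @ y) = 0" by simp
  qed
  moreover have "?Z b y = ssum y (\<lambda>v z. 0)"
  proof (rule ssum_cong)
    fix v z assume "v @ z = y" "z \<noteq> []"
    then have "last z = last y" "set z \<subseteq> set y" by auto
    then show "M v * \<beta> (z @ b) = 0"
      using \<open>z \<noteq> []\<close> b y by (subst \<beta>_low_top) auto
  qed
  moreover have "ssum y' (\<lambda>u r. ?Z (b @ x # u) r) = ssum y' (\<lambda>u r. M b * ?Z (x # u) r)"
  proof (rule ssum_cong)
    fix u r assume ur: "u @ r = y'" "r \<noteq> []"
    show "?Z (b @ x # u) r = M b * ?Z (x # u) r"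
      unfolding ssum_mult[symmetric]
    proof (rule ssum_cong)
      fix v z assume vz: "v @ z = r" "z \<noteq> []"
      then have "last z = last y" "set z \<subseteq> set y" "set u \<subseteq> set y" using ur x by auto
      then have "\<beta> (z @ b @ x # u) = M b * \<beta> (z @ x # u)"
        using vz b y x by (intro \<beta>_low_top_low) auto
      then show "M v * \<beta> (z @ b @ x # u) = M b * (M v * \<beta> (z @ x # u))" by simp
    qed
  qed
  moreover have "M (b @ y) = M b * M y"
    using M_factor[of "[]" y b] b y by simp
  ultimately show ?thesis
    unfolding c append_Cons \<Omega>_Cons
    using \<Omega>_Cons[of x y'] 
    by (simp add: ssum_append c x ssum_mult distrib_left del: prod_list.append prod_list.Cons)
qed

end

section \<open>Spans of pure tensors\<close>

lemma linear_functional_mult: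
  fixes f :: "'a::complex_algebra_1 \<Rightarrow> complex"
  assumes "linear_functional f"
  shows "linear_functional (\<lambda>x. c * f (l * x * r))"
proof -
  interpret Vector_Spaces.linear scaleC "(*)" f by (rule assms)
  show ?thesis
    by unfold_locales
      (simp_all add: distrib_left distrib_right mult_scaleC_left mult_scaleC_right add scale mult.left_commute)
qed

lemma linear_functional_eq_on_span:
  fixes f g :: "'a::complex_vector \<Rightarrow> complex"
  assumes "linear_functional f" "linear_functional g"
    and "\<And>x. x \<in> S \<Longrightarrow> f x = g x" and "x \<in> complex_vector.span S"
  shows "f x = g x"
proof -
  interpret f: Vector_Spaces.linear scaleC "(*)" f by (rule assms(1))
  interpret g: Vector_Spaces.linear scaleC "(*)" g by (rule assms(2))
  show ?thesis
    using assms(4)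
    by (induction rule: complex_vector.span_induct_alt)
      (simp_all add: f.add g.add f.scale g.scale f.zero g.zero assms(3))
qed

abbreviation word_span :: "'a::complex_vector list set \<Rightarrow> 'a tensor_algebra set" where
  "word_span W \<equiv> complex_vector.span (pure_tensor ` W)"

lemma word_span_UNIV: "x \<in> word_span UNIV"
proof -
  obtain p where x: "x = abs_tensor_algebra p"
    using Quotient3_abs_rep[OF Quotient3_tensor_algebra] by metis
  have "abs_tensor_algebra p \<in> word_span UNIV"
  proof (induction p rule: free_algebra_induct)
    case zero
    then show ?case
      using complex_vector.span_zero by (simp add: zero_tensor_algebra.abs_eq[symmetric])
  next
    case (add w c p)
    have "abs_tensor_algebra (Poly_Mapping.single w c + p) =
        c *\<^sub>C pure_tensor w + abs_tensor_algebra p"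
      by (simp add: pure_tensor.abs_eq scaleC_tensor_algebra.abs_eq plus_tensor_algebra.abs_eq
          mult_single)
    then show ?case
      using add by (simp add: complex_vector.span_add complex_vector.span_scale complex_vector.span_base)
  qed
  then show ?thesis by (simp add: x)
qed

lemma linear_functional_eq_on_word_span:
  assumes "linear_functional f" "linear_functional g" "x \<in> word_span W"
    and "\<And>w. w \<in> W \<Longrightarrow> f (pure_tensor w) = g (pure_tensor w)"
  shows "f x = g x"
  using linear_functional_eq_on_span[OF assms(1,2) _ assms(3)] assms(4) by blast

lemma word_span_mono: "U \<subseteq> W \<Longrightarrow> x \<in> word_span U \<Longrightarrow> x \<in> word_span W"
  by (meson complex_vector.span_mono image_mono subsetD)

lemma word_span_mult:
  assumes "x \<in> word_span U" "y \<in> word_span V" and app: "\<And>u v. u \<in> U \<Longrightarrow> v \<in> V \<Longrightarrow> u @ v \<in> W"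
  shows "x * y \<in> word_span W"
  using assms(1)
proof (induction rule: complex_vector.span_induct_alt)
  case base
  then show ?case by (simp add: complex_vector.span_zero)
next
  case (step c u x)
  then obtain w where w: "w \<in> U" "u = pure_tensor w" by auto
  have "u * y \<in> word_span W"
    using assms(2)
  proof (induction rule: complex_vector.span_induct_alt)
    case base
    then show ?case by (simp add: complex_vector.span_zero)
  next
    case (step d v y)
    then obtain w' where "w' \<in> V" "v = pure_tensor w'" by auto
    then have "u * v \<in> word_span W"
      using w app by (auto simp flip: pure_tensor_append intro: complex_vector.span_base)
    then show ?case
      using step by (simp add: distrib_left mult_scaleC_right complex_vector.span_add complex_vector.span_scale)
  qed
  then show ?case
    using step by (simp add: distrib_right mult_scaleC_left complex_vector.span_add complex_vector.span_scale)
qed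

lemma reduced_tensor_algebra_eq:
  "reduced_tensor_algebra B = word_span {w. w \<noteq> [] \<and> set w \<subseteq> B}"
  by (simp add: reduced_tensor_algebra_def setcompr_eq_image)

lemma reduced_tensor_algebra_mono:
  "B \<subseteq> C \<Longrightarrow> reduced_tensor_algebra B \<subseteq> reduced_tensor_algebra C"
  unfolding reduced_tensor_algebra_eq by (intro complex_vector.span_mono image_mono) auto

lemma reduced_tensor_algebra_mult:
  "x \<in> reduced_tensor_algebra B \<Longrightarrow> y \<in> reduced_tensor_algebra B \<Longrightarrow>
    x * y \<in> reduced_tensor_algebra B"
  unfolding reduced_tensor_algebra_eq by (erule word_span_mult) auto

lemma generated_algebra_reduced_tensor_algebra:
  "generated_algebra (\<Union>i\<in>I. reduced_tensor_algebra (B i)) \<subseteq> reduced_tensor_algebra (\<Union>i\<in>I. B i)"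
  unfolding generated_algebra_def
proof (rule hull_minimal)
  show "(\<Union>i\<in>I. reduced_tensor_algebra (B i)) \<subseteq> reduced_tensor_algebra (\<Union>i\<in>I. B i)"
    by (intro UN_least reduced_tensor_algebra_mono) blast
  show "nonunital_subalgebra (reduced_tensor_algebra (\<Union>i\<in>I. B i))"
    using reduced_tensor_algebra_mult
    by (auto simp: nonunital_subalgebra_def reduced_tensor_algebra_def)
qed

context unital_functional
begin

abbreviation \<Phi> :: "'a tensor_algebra \<Rightarrow> complex" where "\<Phi> \<equiv> tensor_moment \<phi>"
abbreviation \<Psi> :: "'a tensor_algebra \<Rightarrow> complex" where "\<Psi> \<equiv> cyclic_functional \<phi>"

lemma \<Phi>_linear: "linear_functional \<Phi>"
  unfolding tensor_moment_def by (rule tensor_functional_linear[OF M_multilinear])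

lemma \<Psi>_linear: "linear_functional \<Psi>"
  unfolding cyclic_functional_def by (rule tensor_functional_linear[OF \<Omega>_multilinear])

lemma \<Phi>_pure: "\<Phi> (pure_tensor w) = M w"
  by (rule tensor_moment_pure_tensor[OF linear])

lemma \<Psi>_pure: "\<Psi> (pure_tensor w) = \<Omega> w"
  unfolding cyclic_functional_def by (rule tensor_functional_pure_tensor[OF \<Omega>_multilinear])

lemma \<Phi>_one: "\<Phi> 1 = 1"
  using \<Phi>_pure[of "[]"] by (simp add: pure_tensor_Nil unital)

lemma \<Psi>_commute: "\<Psi> (x * y) = \<Psi> (y * x)"
proof -
  note lin = linear_functional_mult[OF \<Psi>_linear, of 1]
  have words: "\<Psi> (pure_tensor u * pure_tensor v) = \<Psi> (pure_tensor v * pure_tensor u)" for u v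
    using \<Omega>_commute[of u v] by (simp only: \<Psi>_pure flip: pure_tensor_append)
  have word: "\<Psi> (pure_tensor u * y) = \<Psi> (y * pure_tensor u)" for u
    using words linear_functional_eq_on_word_span[OF lin[of "pure_tensor u" 1] lin[of 1 "pure_tensor u"]
        word_span_UNIV[of y]]
    by simp
  show ?thesis
    using linear_functional_eq_on_word_span[OF lin[of 1 y] lin[of y 1]
        word_span_UNIV[of x]]
    by (simp add: word)
qed

end

context monotone_letters
begin

lemma \<Phi>_factor:
  assumes x: "x \<in> word_span {w. set w \<subseteq> X \<union> Y \<and> (w \<noteq> [] \<longrightarrow> last w \<in> X)}" (is "_ \<in> word_span ?L")
    and b: "b \<in> reduced_tensor_algebra Y"
    and y: "y \<in> word_span {w. set w \<subseteq> X \<union> Y \<and> (w \<noteq> [] \<longrightarrow> hd w \<in> X)}" (is "_ \<in> word_span ?R")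
  shows "\<Phi> (x * b * y) = \<Phi> b * \<Phi> (x * y)"
proof -
  note lin = linear_functional_mult[OF \<Phi>_linear]
  let ?p = "pure_tensor :: 'a list \<Rightarrow> _"
  have 1: "\<Phi> (?p u * ?p w * ?p v) = \<Phi> (?p w) * \<Phi> (?p u * ?p v)"
    if "u \<in> ?L" "w \<noteq> []" "set w \<subseteq> Y" "v \<in> ?R" for u v w
    using M_factor[of u v w] that by (simp add: \<Phi>_pure flip: pure_tensor_append)
  have 2: "\<Phi> (x * ?p w * ?p v) = \<Phi> (?p w) * \<Phi> (x * ?p v)"
    if "w \<noteq> []" "set w \<subseteq> Y" "v \<in> ?R" for v w
    using linear_functional_eq_on_word_span[OF lin[of 1 1 "?p w * ?p v"] lin[of "\<Phi> (?p w)" 1 "?p v"]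
        x]
      1[OF _ that] by (simp add: mult.assoc)
  have 3: "\<Phi> (x * b * ?p v) = \<Phi> b * \<Phi> (x * ?p v)" if "v \<in> ?R" for v
    using linear_functional_eq_on_word_span[OF lin[of 1 x "?p v"] lin[of "\<Phi> (x * ?p v)" 1 1]
        b[unfolded reduced_tensor_algebra_eq]] 2[OF _ _ that]
    by (simp add: mult.commute)
  show ?thesis
    using linear_functional_eq_on_word_span[OF lin[of 1 "x * b" 1] lin[of "\<Phi> b" x 1]
        y] 3 by simp
qed

abbreviation low_words :: "'a list set" where
  "low_words \<equiv> {w. w \<noteq> [] \<and> set w \<subseteq> X \<union> Y \<and> hd w \<in> X \<and> last w \<in> X}"

lemma \<Psi>_factor:
  assumes b: "b \<in> reduced_tensor_algebra Y" and y: "y \<in> word_span low_words"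
  shows "\<Psi> (b * y) = \<Phi> b * \<Psi> y"
proof -
  note lin = linear_functional_mult[OF \<Psi>_linear]
  let ?p = "pure_tensor :: 'a list \<Rightarrow> _"
  have 1: "\<Psi> (?p w * ?p v) = \<Phi> (?p w) * \<Psi> (?p v)" if "w \<noteq> []" "set w \<subseteq> Y" "v \<in> low_words" for v w
    using \<Omega>_top_low[of w v] that by (simp add: \<Psi>_pure \<Phi>_pure flip: pure_tensor_append)
  have 2: "\<Psi> (?p w * y) = \<Phi> (?p w) * \<Psi> y" if "w \<noteq> []" "set w \<subseteq> Y" for w
    using linear_functional_eq_on_word_span[OF lin[of 1 "?p w" 1] lin[of "\<Phi> (?p w)" 1 1]
        y]
      1[OF that] by simp
  show ?thesis
    using linear_functional_eq_on_word_span[OF lin[of 1 1 y] linear_functional_mult[OF \<Phi>_linear, of "\<Psi> y" 1 1]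
        b[unfolded reduced_tensor_algebra_eq]] 2
    by (simp add: mult.commute)
qed

lemma low_words_sandwich:
  assumes "d \<in> word_span low_words" "b \<in> reduced_tensor_algebra Y" "c \<in> word_span low_words"
  shows "d * b * c \<in> word_span low_words"
proof -
  have "d * b \<in> word_span {w. w \<noteq> [] \<and> set w \<subseteq> X \<union> Y \<and> hd w \<in> X}"
    using assms(1,2) unfolding reduced_tensor_algebra_eq by (rule word_span_mult) auto
  then show ?thesis
    using assms(3) by (rule word_span_mult) auto
qed

lemma reduced_tensor_algebra_low_words: "c \<in> reduced_tensor_algebra X \<Longrightarrow> c \<in> word_span low_words"
  unfolding reduced_tensor_algebra_eq
  by (erule word_span_mono[rotated]) (auto dest: hd_in_set last_in_set)

lemma low_words_mult:
  "d \<in> word_span low_words \<Longrightarrow> c \<in> word_span low_words \<Longrightarrow> d * c \<in> word_span low_words"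
  by (erule word_span_mult) auto

lemma low_words_alternating:
  assumes "\<forall>i\<in>{1..m}. a i \<in> reduced_tensor_algebra X" "\<forall>i\<in>{1..m}. b i \<in> reduced_tensor_algebra Y"
    and "c \<in> word_span low_words"
  shows "prod_list (map (\<lambda>i. a i * b i) [1..<m + 1]) * c \<in> word_span low_words"
  using assms
proof (induction m arbitrary: c)
  case (Suc m)
  let ?R = "prod_list (map (\<lambda>i. a i * b i) [1..<m + 1])"
  have "?R * a (Suc m) \<in> word_span low_words"
    using Suc.prems by (intro Suc.IH reduced_tensor_algebra_low_words) auto
  then have "?R * a (Suc m) * b (Suc m) * c \<in> word_span low_words"
    using Suc.prems by (intro low_words_sandwich) auto
  then show ?case by (simp add: mult.assoc)
qed simp

lemma \<Psi>_alternating: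
  assumes "\<forall>i\<in>{1..m}. a i \<in> reduced_tensor_algebra X" "\<forall>i\<in>{1..m}. b i \<in> reduced_tensor_algebra Y"
    and "d \<in> reduced_tensor_algebra X"
  shows "\<Psi> (prod_list (map (\<lambda>i. a i * b i) [1..<m + 1]) * d) =
    \<Psi> (prod_list (map a [1..<m + 1]) * d) * (\<Prod>i\<in>{1..<m + 1}. \<Phi> (b i))"
  using assms
proof (induction m arbitrary: d)
  case (Suc m)
  let ?R = "prod_list (map (\<lambda>i. a i * b i) [1..<m + 1])"
  let ?a = "a (Suc m)" and ?b = "b (Suc m)"
  have ab: "?a \<in> reduced_tensor_algebra X" "?b \<in> reduced_tensor_algebra Y"
    using Suc.prems by auto
  have "\<Psi> (?R * (?a * ?b) * d) = \<Psi> (?b * (d * ?R * ?a))"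
    using \<Psi>_commute[of "?R * ?a" "?b * d"] by (simp add: mult.assoc)
  also have "\<dots> = \<Phi> ?b * \<Psi> (d * ?R * ?a)"
    unfolding mult.assoc[of d] using Suc.prems ab
    by (intro \<Psi>_factor low_words_mult low_words_alternating reduced_tensor_algebra_low_words) auto
  also have "\<Psi> (d * ?R * ?a) = \<Psi> (?R * (?a * d))"
    using \<Psi>_commute[of d "?R * ?a"] by (simp add: mult.assoc)
  also have "\<dots> = \<Psi> (prod_list (map a [1..<m + 1]) * (?a * d)) * (\<Prod>i\<in>{1..<m + 1}. \<Phi> (b i))"
    using Suc.prems ab by (intro Suc.IH reduced_tensor_algebra_mult) auto
  finally show ?case by (simp add: mult.assoc mult.left_commute)
qed simp

lemma \<Psi>_cyclic:
  assumes "1 \<le> m" "\<forall>i\<in>{1..m}. a i \<in> reduced_tensor_algebra X"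
    "\<forall>i\<in>{0..m}. b i \<in> reduced_tensor_algebra Y"
  shows "\<Psi> (b 0 * prod_list (map (\<lambda>i. a i * b i) [1..<m + 1])) =
    \<Psi> (prod_list (map a [1..<m + 1])) * (\<Prod>i\<in>{1..<m}. \<Phi> (b i)) * \<Phi> (b m * b 0)"
proof -
  obtain l where m: "m = Suc l" using assms(1) by (cases m) auto
  let ?R = "prod_list (map (\<lambda>i. a i * b i) [1..<l + 1])"
  have am: "a m \<in> reduced_tensor_algebra X"
    and bb: "b m * b 0 \<in> reduced_tensor_algebra Y"
    using assms by (auto intro: reduced_tensor_algebra_mult)
  have mem: "?R * a m \<in> word_span low_words"
    using assms am by (intro low_words_alternating reduced_tensor_algebra_low_words) (auto simp: m)
  have "\<Psi> (b 0 * prod_list (map (\<lambda>i. a i * b i) [1..<m + 1])) = \<Psi> (b m * b 0 * (?R * a m))"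
    using \<Psi>_commute[of "b 0 * ?R * a m" "b m"] by (simp add: m mult.assoc)
  also have "\<dots> = \<Phi> (b m * b 0) * \<Psi> (?R * a m)"
    by (rule \<Psi>_factor[OF bb mem])
  also have "\<Psi> (?R * a m) = \<Psi> (prod_list (map a [1..<l + 1]) * a m) * (\<Prod>i\<in>{1..<l + 1}. \<Phi> (b i))"
    using assms am by (intro \<Psi>_alternating) (auto simp: m)
  finally show ?thesis by (simp add: m mult.commute)
qed

end

section \<open>Cyclic monotone independence\<close>

lemma prod_list_word_span:
  "\<forall>x\<in>set xs. x \<in> reduced_tensor_algebra Z \<Longrightarrow> prod_list xs \<in> word_span {w. set w \<subseteq> Z}"
proof (induction xs)
  case Nil
  have "pure_tensor [] \<in> word_span {w. set w \<subseteq> Z}"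
    by (intro complex_vector.span_base imageI) simp
  then show ?case by (simp add: pure_tensor_Nil)
next
  case (Cons x xs)
  then have "x \<in> word_span {w. w \<noteq> [] \<and> set w \<subseteq> Z}" "prod_list xs \<in> word_span {w. set w \<subseteq> Z}"
    by (simp_all add: reduced_tensor_algebra_eq)
  then have "x * prod_list xs \<in> word_span {w. set w \<subseteq> Z}"
    by (rule word_span_mult) auto
  then show ?case by simp
qed

lemma upt_split: "1 \<le> k \<Longrightarrow> k \<le> m \<Longrightarrow> [1..<m + 1] = [1..<k] @ [k] @ [k + 1..<m + 1]"
  using upt_add_eq_append[of 1 k "m + 1 - k"] by (simp add: upt_conv_Cons del: upt_Suc)

lemma monotone_independent_words:
  assumes "monotone_independent \<phi> n B"
    and u: "\<forall>(j, x)\<in>set u. j \<in> {1..n} \<and> x \<in> B j" and v: "\<forall>(j, x)\<in>set v. j \<in> {1..n} \<and> x \<in> B j"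
    and y: "l \<in> {1..n}" "y \<in> B l"
    and peak: "u \<noteq> [] \<Longrightarrow> fst (last u) < l" "v \<noteq> [] \<Longrightarrow> fst (hd v) < l"
  shows "\<phi> (prod_list (map snd u) * y * prod_list (map snd v)) =
    \<phi> y * \<phi> (prod_list (map snd u) * prod_list (map snd v))"
proof -
  define w where "w = u @ (l, y) # v"
  define j where "j i = fst (w ! (i - 1))" for i
  define a where "a i = snd (w ! (i - 1))" for i
  define k where "k = Suc (length u)"
  define m where "m = length w"
  have k: "1 \<le> k" "k \<le> m" "j k = l" "a k = y"
    by (simp_all add: k_def m_def w_def j_def a_def)
  have letters: "\<forall>i\<in>{1..m}. j i \<in> {1..n} \<and> a i \<in> B (j i)"
  proof
    fix i assume "i \<in> {1..m}"
    then have "w ! (i - 1) \<in> set w" by (intro nth_mem) (auto simp: m_def)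
    moreover have "\<forall>(j, x)\<in>set w. j \<in> {1..n} \<and> x \<in> B j" using u v y by (auto simp: w_def)
    ultimately show "j i \<in> {1..n} \<and> a i \<in> B (j i)"
      by (auto simp: j_def a_def case_prod_beta)
  qed
  have left: "1 < k \<longrightarrow> j (k - 1) < j k"
  proof
    assume "1 < k"
    then have "u \<noteq> []" by (auto simp: k_def)
    then have "j (k - 1) = fst (last u)"
      by (simp add: j_def k_def w_def last_conv_nth nth_append)
    then show "j (k - 1) < j k" using k(3) peak(1) \<open>u \<noteq> []\<close> by simp
  qed
  have right: "k < m \<longrightarrow> j k > j (k + 1)"
  proof
    assume "k < m"
    then have "v \<noteq> []" by (auto simp: k_def m_def w_def)
    then have "j (k + 1) = fst (hd v)"
      by (simp add: j_def k_def w_def hd_conv_nth nth_append)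
    then show "j k > j (k + 1)" using k(3) peak(2) \<open>v \<noteq> []\<close> by simp
  qed
  have au: "map a [1..<k] = map snd u"
    by (rule nth_equalityI) (auto simp: k_def a_def w_def nth_append simp del: upt_Suc)
  have av: "map a [k + 1..<m + 1] = map snd v"
    by (rule nth_equalityI) (auto simp: k_def m_def a_def w_def nth_append simp del: upt_Suc)
  have "\<phi> (prod_list (map a [1..<m + 1])) = \<phi> (prod_list (map snd u) * y * prod_list (map snd v))"
    unfolding upt_split[OF k(1,2)] map_append au av by (simp add: k(4) mult.assoc)
  moreover have "\<phi> (prod_list (map a [1..<m + 1])) =
      \<phi> (a k) * \<phi> (prod_list (map a ([1..<k] @ [k + 1..<m + 1])))"
    using assms(1) k(1,2) letters left right unfolding monotone_independent_def by blast
  ultimately show ?thesis using au av k(4) by simp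
qed

lemma prod_list_nonunital_subalgebra:
  "nonunital_subalgebra B \<Longrightarrow> b \<noteq> [] \<Longrightarrow> set b \<subseteq> B \<Longrightarrow> prod_list b \<in> B"
proof (induction b)
  case (Cons x b)
  then show ?case by (cases "b = []") (auto simp: nonunital_subalgebra_def)
qed simp

lemma monotone_letters_if_monotone_independent:
  assumes "linear_functional \<phi>" "\<phi> 1 = 1" "monotone_independent \<phi> n A"
    and k: "k \<in> {2..n}" and sub: "nonunital_subalgebra (A k)"
  shows "monotone_letters \<phi> (\<Union>i\<in>{1..<k}. A i) (A k)"
proof (intro monotone_letters.intro unital_functional.intro monotone_letters_axioms.intro)
  let ?X = "\<Union>i\<in>{1..<k}. A i"
  define level where "level x = (if x \<in> ?X then SOME i. i \<in> {1..<k} \<and> x \<in> A i else k)" for x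
  have low: "level x \<in> {1..<k} \<and> x \<in> A (level x)" if "x \<in> ?X" for x
  proof -
    have "\<exists>i. i \<in> {1..<k} \<and> x \<in> A i" using that by blast
    from someI_ex[OF this] show ?thesis using that by (simp add: level_def)
  qed
  have all: "level x \<in> {1..n} \<and> x \<in> A (level x)" if "x \<in> ?X \<union> A k" for x
    using low[of x] that k by (cases "x \<in> ?X") (auto simp: level_def)
  fix u v b :: "'a list"
  assume u: "set u \<subseteq> ?X \<union> A k" and v: "set v \<subseteq> ?X \<union> A k" and b: "b \<noteq> []" "set b \<subseteq> A k"
    and peak: "u \<noteq> [] \<Longrightarrow> last u \<in> ?X" "v \<noteq> [] \<Longrightarrow> hd v \<in> ?X"
  let ?l = "map (\<lambda>x. (level x, x))"
  have "\<phi> (prod_list (map snd (?l u)) * prod_list b * prod_list (map snd (?l v))) =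
      \<phi> (prod_list b) * \<phi> (prod_list (map snd (?l u)) * prod_list (map snd (?l v)))"
  proof (rule monotone_independent_words[OF assms(3)])
    show "k \<in> {1..n}" using k by simp
    show "prod_list b \<in> A k" by (rule prod_list_nonunital_subalgebra[OF sub b])
    show "\<forall>(j, x)\<in>set (?l u). j \<in> {1..n} \<and> x \<in> A j" using u all by fastforce
    show "\<forall>(j, x)\<in>set (?l v). j \<in> {1..n} \<and> x \<in> A j" using v all by fastforce
    show "fst (last (?l u)) < k" if "?l u \<noteq> []"
      using low[OF peak(1)] that by (simp add: last_map)
    show "fst (hd (?l v)) < k" if "?l v \<noteq> []"
      using low[OF peak(2)] that by (simp add: hd_map)
  qed
  then show "\<phi> (prod_list (u @ b @ v)) = \<phi> (prod_list b) * \<phi> (prod_list (u @ v))"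
    by (simp add: comp_def mult.assoc)
qed (fact assms)+

context monotone_letters
begin

lemma monotone_independent_\<Phi>:
  assumes "B \<subseteq> reduced_tensor_algebra X"
  shows "monotone_independent \<Phi> 2 (\<lambda>i. if i = 1 then B else reduced_tensor_algebra Y)"
  unfolding monotone_independent_def
proof (intro allI impI, elim conjE)
  fix m k :: nat and a and j :: "nat \<Rightarrow> nat"
  assume k: "1 \<le> k" "k \<le> m"
    and letters: "\<forall>i\<in>{1..m}. j i \<in> {1..2} \<and> a i \<in> (if j i = 1 then B else reduced_tensor_algebra Y)"
    and left: "1 < k \<longrightarrow> j (k - 1) < j k" and right: "k < m \<longrightarrow> j k > j (k + 1)"
  have j: "j i \<in> {1, 2}" if "i \<in> {1..m}" for i using letters that by fastforce
  have low: "a i \<in> reduced_tensor_algebra X" if "i \<in> {1..m}" "j i < j k" for i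
  proof -
    have "j i = 1" using j[OF that(1)] j[of k] that(2) k by auto
    then show ?thesis using bspec[OF letters that(1)] assms by auto
  qed
  have any: "a i \<in> reduced_tensor_algebra (X \<union> Y)" if "i \<in> {1..m}" for i
    using bspec[OF letters that] assms reduced_tensor_algebra_mono[of X "X \<union> Y"]
      reduced_tensor_algebra_mono[of Y "X \<union> Y"]
    by (cases "j i = 1") auto
  let ?x = "prod_list (map a [1..<k])" and ?y = "prod_list (map a [k + 1..<m + 1])"
  have "\<Phi> (?x * a k * ?y) = \<Phi> (a k) * \<Phi> (?x * ?y)"
  proof (cases "j k = 1")
    case True
    have "\<not> 1 < k" using left j[of "k - 1"] True k by fastforce
    moreover have "\<not> k < m" using right j[of "k + 1"] True by fastforce
    ultimately have "k = 1" "m = 1" using k by auto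
    then show ?thesis by (simp add: \<Phi>_one)
  next
    case False
    let ?all = "{w. set w \<subseteq> X \<union> Y}" and ?low = "{w. w \<noteq> [] \<and> set w \<subseteq> X}"
    have one: "1 \<in> word_span W" if "[] \<in> W" for W :: "'a list set"
      using complex_vector.span_base[OF imageI[OF that, of pure_tensor]] by (simp add: pure_tensor_Nil)
    show ?thesis
    proof (rule \<Phi>_factor)
      show "a k \<in> reduced_tensor_algebra Y" using bspec[OF letters, of k] k False by auto
      show "?x \<in> word_span {w. set w \<subseteq> X \<union> Y \<and> (w \<noteq> [] \<longrightarrow> last w \<in> X)}"
      proof (cases "k = 1")
        case False
        then obtain l where l: "k = Suc l" "1 \<le> l" using k by (cases k) auto
        have "prod_list (map a [1..<l]) \<in> word_span ?all"
          using any k l by (intro prod_list_word_span) auto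
        moreover have "a l \<in> word_span ?low"
          using low[of l] left k l by (auto simp: reduced_tensor_algebra_eq)
        ultimately have "prod_list (map a [1..<l]) * a l \<in>
            word_span {w. set w \<subseteq> X \<union> Y \<and> (w \<noteq> [] \<longrightarrow> last w \<in> X)}"
          by (rule word_span_mult) auto
        then show ?thesis using l by simp
      qed (simp add: one)
      show "?y \<in> word_span {w. set w \<subseteq> X \<union> Y \<and> (w \<noteq> [] \<longrightarrow> hd w \<in> X)}"
      proof (cases "k = m")
        case False
        then have "k < m" using k by simp
        have "prod_list (map a [k + 2..<m + 1]) \<in> word_span ?all"
          using any by (intro prod_list_word_span) auto
        moreover have "a (k + 1) \<in> word_span ?low"
          using low[of "k + 1"] right \<open>k < m\<close> by (auto simp: reduced_tensor_algebra_eq)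
        ultimately have "a (k + 1) * prod_list (map a [k + 2..<m + 1]) \<in>
            word_span {w. set w \<subseteq> X \<union> Y \<and> (w \<noteq> [] \<longrightarrow> hd w \<in> X)}"
          by (intro word_span_mult[of _ ?low _ ?all]) auto
        then show ?thesis using \<open>k < m\<close> by (simp add: upt_conv_Cons del: upt_Suc)
      qed (simp add: one)
    qed
  qed
  then show "\<Phi> (prod_list (map a [1..<m + 1])) =
      \<Phi> (a k) * \<Phi> (prod_list (map a ([1..<k] @ [k + 1..<m + 1])))"
    unfolding upt_split[OF k] by (simp add: mult.assoc del: upt_Suc)
qed

lemma cyclically_monotone_pair_\<Phi>_\<Psi>:
  assumes "B \<subseteq> reduced_tensor_algebra X"
  shows "cyclically_monotone_pair \<Phi> \<Psi> B (reduced_tensor_algebra Y)"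
  unfolding cyclically_monotone_pair_def
  using monotone_independent_\<Phi>[OF assms] \<Psi>_cyclic assms by blast

end

theorem corollary1p12:
  fixes \<phi> :: "'a::complex_algebra_1 \<Rightarrow> complex"
    and A :: "nat \<Rightarrow> 'a set"
    and n :: nat
  assumes "linear_functional \<phi>"
    and "\<phi> 1 = 1"
    and "\<forall>i\<in>{1..n}. nonunital_subalgebra (A i)"
    and "monotone_independent \<phi> n A"
  shows "cyclically_monotone_independent (tensor_moment \<phi>) (cyclic_functional \<phi>) n
           (\<lambda>i. reduced_tensor_algebra (A i))"
proof -
  interpret unital_functional \<phi> by (rule unital_functional.intro) (fact assms)+
  have "cyclically_monotone_pair \<Phi> \<Psi> (generated_algebra (\<Union>i\<in>{1..<k}. reduced_tensor_algebra (A i)))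
      (reduced_tensor_algebra (A k))" if k: "k \<in> {2..n}" for k
  proof -
    have "nonunital_subalgebra (A k)" using assms(3) k by simp
    then interpret monotone_letters \<phi> "\<Union>i\<in>{1..<k}. A i" "A k"
      using assms k by (intro monotone_letters_if_monotone_independent)
    show ?thesis
      by (rule cyclically_monotone_pair_\<Phi>_\<Psi>[OF generated_algebra_reduced_tensor_algebra])
  qed
  then show ?thesis
    using \<Psi>_linear \<Psi>_commute by (simp add: cyclically_monotone_independent_def tracial_def)
qed

end
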